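(* For each $p\ge0$ let $\psi=\psi_p:\Lambda^{p+1}V^{\vee}\to\mathcal{O}_{GL(V)}\underset{bal}{\otimes}L\otimes\Lambda^pW$ be the map defined in the context. 1. The image of $\psi$ consists of $H$-invariants. 2. The map $\psi$ is proportional to the isomorphism of $GL(V)$-modules obtained as the composition $$\Lambda^{p+1}V^{\vee}\cong H^0(\mathbb{P}V,\Omega^p(p+1))\cong(\mathcal{O}_{GL(V)}\underset{bal}{\otimes}L\otimes\Lambda^pW)^H$$ of the Koszul description and the associated-bundle description of $H^0(\mathbb{P}V,\Omega^p(p+1))$ given in the context.
   Context: $k$ is a field of characteristic zero and $V$ a finite-dimensional $k$-vector space. Fix $0\neq v_0\in V$; $[v_0]$ denotes the line $kv_0$ and the point of $\mathbb{P}V$; $H\subset GL(V)$ is the stabilizer of $[v_0]$; $L=[v_0]^{\vee}$, $W=(V/[v_0])^{\vee}$ as $H$-representations. For an $H$-representation $M$, $\mathcal{O}_{GL(V)}\underset{bal}{\otimes}M$ is the space of regular maps $\varphi:GL(V)\to M$ equipped with the right $H$-action whose invariants are the $\varphi$ with $\varphi(gh)=h^{-1}\varphi(g)$; $GL(V)$ acts by left translation. Definition of $\psi$: compose the coaction $\Lambda^{p+1}V^{\vee}\to\mathcal{O}_{GL(V)}\otimes\Lambda^{p+1}V^{\vee}$ (dual to the action $GL(V)\times\Lambda^{p+1}V\to\Lambda^{p+1}V$, i.e. $\xi\mapsto(g\mapsto\xi(g\,\cdot))$) with $\mathrm{id}\otimes$ the dual of the exterior product map $[v_0]\otimes\Lambda^p(V/[v_0])\to\Lambda^{p+1}V$.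 Koszul description: $\Omega^p$ is the sheaf of algebraic $p$-forms on $\mathbb{P}V$ and $(m)$ is the twist by $\mathcal{O}(m)$. From the Euler sequence, $H^0(\mathbb{P}V,\Omega^p(p+1))$ is identified with $\ker(\delta:\Lambda^pV^{\vee}\otimes V^{\vee}\to\Lambda^{p-1}V^{\vee}\otimes\mathrm{Sym}^2V^{\vee})$, which is the isomorphic image of $\Lambda^{p+1}V^{\vee}$ under $\delta:\Lambda^{p+1}V^{\vee}\to\Lambda^pV^{\vee}\otimes V^{\vee}$, where $\delta$ is the Koszul differential $\delta(\xi_1\cdots\xi_p\otimes f)=\sum_i(-1)^{i-1}\xi_1\cdots\widehat{\xi_i}\cdots\xi_p\otimes\xi_if$. Associated-bundle description: $\Omega^p(p+1)$ is the homogeneous bundle $GL(V)\times_H(L\otimes\Lambda^pW)$ over $\mathbb{P}V=GL(V)/H$, so its global sections are the $H$-equivariant regular maps $GL(V)\to L\otimes\Lambda^pW$, i.e. $(\mathcal{O}_{GL(V)}\underset{bal}{\otimes}L\otimes\Lambda^pW)^H$. *)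

theory Defs
  imports "HOL-Library.Function_Algebras" "Jordan_Normal_Form.Determinant"
begin

text \<open>
  \<open>V\<close> is the whole type \<open>'v\<close>, with scalar multiplication \<open>scale\<close>.  The field has characteristic
  zero, hence is infinite, so regular functions on \<open>V\<close>, on \<open>GL(V)\<close> and on the standard affine charts
  of the projective space are determined by their values at \<open>k\<close>-points.  They are represented by
  these values, but regularity is always membership in the coordinate ring: being locally a
  fraction whose denominator has no zero at a \<open>k\<close>-point would not be enough.

  A \<open>q\<close>-tuple of vectors is a function \<open>x :: nat \<Rightarrow> 'v\<close>, of which only \<open>x 0, \<dots>, x (q - 1)\<close> matter;
  \<open>case_nat v x\<close> is the tuple \<open>v, x 0, x 1, \<dots>\<close>.  Vector space operations on spaces of functions
  are pointwise.  Functions with a restricted domain are extended by 0.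
\<close>

context
  fixes scale :: "'k::field_char_0 \<Rightarrow> 'v::ab_group_add \<Rightarrow> 'v"  (infixr "\<cdot>" 75)
begin

definition dual_space :: "('v \<Rightarrow> 'k) set" where
  "dual_space = {f. Vector_Spaces.linear scale (*) f}"

definition GL :: "('v \<Rightarrow> 'v) set" where
  "GL = {g. Vector_Spaces.linear scale scale g \<and> bij g}"

definition line :: "'v \<Rightarrow> 'v set" where
  "line v0 = module.span scale {v0}"

definition line_stabilizer :: "'v \<Rightarrow> ('v \<Rightarrow> 'v) set" where
  "line_stabilizer v0 = {h \<in> GL. h ` line v0 = line v0}"


text \<open>
  The exterior power \<open>\<Lambda>\<^sup>q U\<^sup>\<or> = (\<Lambda>\<^sup>q U)\<^sup>\<or>\<close> of a subspace \<open>U\<close>, as the space of alternating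
  \<open>q\<close>-linear forms on \<open>U\<close>; see \<open>wedge\<close> below for decomposable elements.
\<close>

definition alt_forms :: "'v set \<Rightarrow> nat \<Rightarrow> ((nat \<Rightarrow> 'v) \<Rightarrow> 'k) set" where
  "alt_forms U q = {\<xi>.
     (\<forall>x y. (\<forall>i<q. x i = y i) \<longrightarrow> \<xi> x = \<xi> y) \<and>
     (\<forall>x. (\<exists>i<q. x i \<notin> U) \<longrightarrow> \<xi> x = 0) \<and>
     (\<forall>x. \<forall>i<q. \<forall>u\<in>U. \<forall>w\<in>U. \<forall>a.
        \<xi> (x(i := a \<cdot> u + w)) = a * \<xi> (x(i := u)) + \<xi> (x(i := w))) \<and>
     (\<forall>x i j. i < j \<and> j < q \<and> x i = x j \<longrightarrow> \<xi> x = 0)}"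

inductive poly_fun :: "('v \<Rightarrow> 'k) \<Rightarrow> bool" where
  poly_fun_const: "poly_fun (\<lambda>v. c)"
| poly_fun_dual: "f \<in> dual_space \<Longrightarrow> poly_fun f"
| poly_fun_add: "poly_fun P \<Longrightarrow> poly_fun Q \<Longrightarrow> poly_fun (\<lambda>v. P v + Q v)"
| poly_fun_mult: "poly_fun P \<Longrightarrow> poly_fun Q \<Longrightarrow> poly_fun (\<lambda>v. P v * Q v)"

text \<open>
  \<open>\<Lambda>\<^sup>q V\<^sup>\<or> \<otimes> Sym\<^sup>d V\<^sup>\<or>\<close>: algebraic \<open>q\<close>-forms on \<open>V\<close> whose coefficients are homogeneous polynomials
  of degree \<open>d\<close>.  The value at the point \<open>v\<close> is \<open>\<eta> v\<close>.
\<close>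

definition alt_sym :: "nat \<Rightarrow> nat \<Rightarrow> ('v \<Rightarrow> (nat \<Rightarrow> 'v) \<Rightarrow> 'k) set" where
  "alt_sym q d = {\<eta>.
     (\<forall>v. \<eta> v \<in> alt_forms UNIV q) \<and>
     (\<forall>x. poly_fun (\<lambda>v. \<eta> v x) \<and> (\<forall>c v. \<eta> (c \<cdot> v) x = c ^ d * \<eta> v x))}"

text \<open>
  The Koszul differential \<open>\<Lambda>\<^sup>q V\<^sup>\<or> \<otimes> Sym\<^sup>d V\<^sup>\<or> \<rightarrow> \<Lambda>\<^sup>q\<^sup>-\<^sup>1 V\<^sup>\<or> \<otimes> Sym\<^sup>d\<^sup>+\<^sup>1 V\<^sup>\<or>\<close>.  On forms with polynomial coefficients
  it is contraction with the tautological vector field; the formula on decomposable elements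
  is \<open>koszul_wedge\<close> below.
\<close>

definition koszul :: "nat \<Rightarrow> ('v \<Rightarrow> (nat \<Rightarrow> 'v) \<Rightarrow> 'k) \<Rightarrow> 'v \<Rightarrow> (nat \<Rightarrow> 'v) \<Rightarrow> 'k" where
  "koszul q \<eta> = (\<lambda>v x. if q = 0 then 0 else \<eta> v (case_nat v x))"

definition koszul_kernel :: "nat \<Rightarrow> ('v \<Rightarrow> (nat \<Rightarrow> 'v) \<Rightarrow> 'k) set" where
  "koszul_kernel p = {\<eta> \<in> alt_sym p 1. koszul p \<eta> = 0}"

text \<open>\<open>\<delta> : \<Lambda>\<^sup>p\<^sup>+\<^sup>1 V\<^sup>\<or> \<rightarrow> \<Lambda>\<^sup>p V\<^sup>\<or> \<otimes> V\<^sup>\<or>\<close>, where \<open>\<Lambda>\<^sup>p\<^sup>+\<^sup>1 V\<^sup>\<or> = \<Lambda>\<^sup>p\<^sup>+\<^sup>1 V\<^sup>\<or> \<otimes> Sym\<^sup>0 V\<^sup>\<or>\<close> are the constant forms.\<close>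

definition koszul_first :: "nat \<Rightarrow> ((nat \<Rightarrow> 'v) \<Rightarrow> 'k) \<Rightarrow> 'v \<Rightarrow> (nat \<Rightarrow> 'v) \<Rightarrow> 'k" where
  "koszul_first p \<xi> = koszul (Suc p) (\<lambda>v. \<xi>)"


text \<open>
  Global sections of \<open>\<Omega>\<^sup>p(m)\<close> on the projective space of lines in \<open>V\<close>, glued from the charts
  \<open>D(l) = {[v]. l v \<noteq> 0}\<close> for all nonzero linear forms \<open>l\<close>.  The chart \<open>D(l)\<close> is identified with the
  affine space \<open>{v. l v = 1}\<close>, whose tangent space at each point is \<open>ker l\<close>, and \<open>O(m)\<close> is
  trivialized on it by \<open>l\<^sup>m\<close>: the section is \<open>s l \<otimes> l\<^sup>m\<close> there, where \<open>s l\<close> is an algebraic \<open>p\<close>-form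
  on \<open>{v. l v = 1}\<close>.  The projection \<open>{v. l v \<noteq> 0} \<rightarrow> D(l)\<close> is \<open>v \<mapsto> v / l v\<close> in this chart, with
  differential \<open>chart_deriv l v\<close> at \<open>v\<close>.
\<close>

definition chart_proj :: "('v \<Rightarrow> 'k) \<Rightarrow> 'v \<Rightarrow> 'v" where
  "chart_proj l v = inverse (l v) \<cdot> v"

definition chart_deriv :: "('v \<Rightarrow> 'k) \<Rightarrow> 'v \<Rightarrow> 'v \<Rightarrow> 'v" where
  "chart_deriv l v w = inverse (l v) \<cdot> w - (l w / (l v)\<^sup>2) \<cdot> v"

definition proj_forms :: "nat \<Rightarrow> nat \<Rightarrow> (('v \<Rightarrow> 'k) \<Rightarrow> 'v \<Rightarrow> (nat \<Rightarrow> 'v) \<Rightarrow> 'k) set" where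
  "proj_forms p m = {s.
     (\<forall>l. l \<notin> dual_space \<longrightarrow> s l = 0) \<and>
     (\<forall>l\<in>dual_space.
        (\<forall>v. l v \<noteq> 1 \<longrightarrow> s l v = 0) \<and>
        (\<forall>v. l v = 1 \<longrightarrow> s l v \<in> alt_forms {w. l w = 0} p) \<and>
        (\<forall>x. (\<forall>i<p. l (x i) = 0) \<longrightarrow> (\<exists>P. poly_fun P \<and> (\<forall>v. l v = 1 \<longrightarrow> s l v x = P v)))) \<and>
     (\<forall>l\<in>dual_space. \<forall>l'\<in>dual_space. \<forall>v x.
        l v = 1 \<and> l' v \<noteq> 0 \<and> (\<forall>i<p. l (x i) = 0) \<longrightarrow>
        s l v x = l' v ^ m * s l' (chart_proj l' v) (chart_deriv l' v \<circ> x))}"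

text \<open>
  The value at \<open>[v]\<close>, \<open>v \<noteq> 0\<close>, of a section of \<open>\<Omega>\<^sup>p(m)\<close>, read as a \<open>p\<close>-form on the tangent space
  \<open>V\<close> of the cone at \<open>v\<close>: the \<open>p\<close>-form part is pulled back along \<open>V - 0 \<rightarrow> \<P>V\<close> and the factor
  in \<open>O(m)\<close>, a homogeneous form of degree \<open>m\<close> on the line \<open>[v]\<close>, is evaluated at \<open>v\<close>.  The chart is chosen so that
  \<open>l v = 1\<close>, and by the gluing condition it does not matter which one is used.
\<close>

definition cone_value :: "(('v \<Rightarrow> 'k) \<Rightarrow> 'v \<Rightarrow> (nat \<Rightarrow> 'v) \<Rightarrow> 'k) \<Rightarrow> 'v \<Rightarrow> (nat \<Rightarrow> 'v) \<Rightarrow> 'k" where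
  "cone_value s v x = (let l = (SOME l. l \<in> dual_space \<and> l v = 1) in s l v (chart_deriv l v \<circ> x))"

text \<open>
  The embedding \<open>\<Omega>\<^sup>p(p + 1) \<rightarrow> \<Lambda>\<^sup>p V\<^sup>\<or> \<otimes> O(1)\<close> from the Euler sequence
  \<open>0 \<rightarrow> \<Omega>\<^sup>1 \<rightarrow> V\<^sup>\<or> \<otimes> O(-1) \<rightarrow> O \<rightarrow> 0\<close>, whose first map is pullback of forms along \<open>V - 0 \<rightarrow> \<P>V\<close>,
  on global sections.
\<close>

definition euler_map :: "(('v \<Rightarrow> 'k) \<Rightarrow> 'v \<Rightarrow> (nat \<Rightarrow> 'v) \<Rightarrow> 'k) \<Rightarrow> 'v \<Rightarrow> (nat \<Rightarrow> 'v) \<Rightarrow> 'k" where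
  "euler_map s = (\<lambda>v x. if v = 0 then 0 else cone_value s v x)"

definition koszul_description ::
    "nat \<Rightarrow> ((nat \<Rightarrow> 'v) \<Rightarrow> 'k) \<Rightarrow> ('v \<Rightarrow> 'k) \<Rightarrow> 'v \<Rightarrow> (nat \<Rightarrow> 'v) \<Rightarrow> 'k" where
  "koszul_description p \<xi> = inv_into (proj_forms p (p + 1)) euler_map (koszul_first p \<xi>)"


text \<open>
  Regular functions on \<open>GL(V)\<close>: the algebra generated by the matrix coefficients of \<open>g\<close> and of
  \<open>g\<^sup>-\<^sup>1\<close>.  It is \<open>k[g\<^sub>i\<^sub>j, 1/det]\<close>, as \<open>1/det g = det g\<^sup>-\<^sup>1\<close> and by Cramer's rule.
\<close>

inductive GL_regular :: "(('v \<Rightarrow> 'v) \<Rightarrow> 'k) \<Rightarrow> bool" where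
  GL_regular_const: "GL_regular (\<lambda>g. c)"
| GL_regular_coeff: "f \<in> dual_space \<Longrightarrow> GL_regular (\<lambda>g. f (g v))"
| GL_regular_inv: "f \<in> dual_space \<Longrightarrow> GL_regular (\<lambda>g. f (inv_into UNIV g v))"
| GL_regular_add: "GL_regular F \<Longrightarrow> GL_regular G \<Longrightarrow> GL_regular (\<lambda>g. F g + G g)"
| GL_regular_mult: "GL_regular F \<Longrightarrow> GL_regular G \<Longrightarrow> GL_regular (\<lambda>g. F g * G g)"

text \<open>
  \<open>L \<otimes> \<Lambda>\<^sup>p W = ([v0] \<otimes> \<Lambda>\<^sup>p (V/[v0]))\<^sup>\<or>\<close>: functions \<open>\<mu> u x\<close>, linear in \<open>u \<in> [v0]\<close> and alternating
  \<open>p\<close>-linear in \<open>x\<close>.  A form on \<open>V/[v0]\<close> is represented by its pullback to \<open>V\<close>; these pullbacks are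
  the forms on \<open>V\<close> vanishing as soon as one argument lies in \<open>[v0]\<close>.
\<close>

definition fibre :: "'v \<Rightarrow> nat \<Rightarrow> ('v \<Rightarrow> (nat \<Rightarrow> 'v) \<Rightarrow> 'k) set" where
  "fibre v0 p = {\<mu>.
     (\<forall>u. u \<notin> line v0 \<longrightarrow> \<mu> u = 0) \<and>
     (\<forall>u\<in>line v0. \<forall>w\<in>line v0. \<forall>a x. \<mu> (a \<cdot> u + w) x = a * \<mu> u x + \<mu> w x) \<and>
     (\<forall>u\<in>line v0. \<mu> u \<in> alt_forms UNIV p \<and> (\<forall>x. (\<exists>i<p. x i \<in> line v0) \<longrightarrow> \<mu> u x = 0))}"

definition fibre_action ::
    "('v \<Rightarrow> 'v) \<Rightarrow> ('v \<Rightarrow> (nat \<Rightarrow> 'v) \<Rightarrow> 'k) \<Rightarrow> 'v \<Rightarrow> (nat \<Rightarrow> 'v) \<Rightarrow> 'k" where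
  "fibre_action h \<mu> = (\<lambda>u x. \<mu> (inv_into UNIV h u) (inv_into UNIV h \<circ> x))"

definition bal_tensor :: "'v \<Rightarrow> nat \<Rightarrow> (('v \<Rightarrow> 'v) \<Rightarrow> 'v \<Rightarrow> (nat \<Rightarrow> 'v) \<Rightarrow> 'k) set" where
  "bal_tensor v0 p = {\<phi>.
     (\<forall>g. g \<notin> GL \<longrightarrow> \<phi> g = 0) \<and>
     (\<forall>g\<in>GL. \<phi> g \<in> fibre v0 p) \<and>
     (\<forall>u x. \<exists>F. GL_regular F \<and> (\<forall>g\<in>GL. \<phi> g u x = F g))}"

definition bal_right_action ::
    "(('v \<Rightarrow> 'v) \<Rightarrow> 'v \<Rightarrow> (nat \<Rightarrow> 'v) \<Rightarrow> 'k) \<Rightarrow> ('v \<Rightarrow> 'v) \<Rightarrow> ('v \<Rightarrow> 'v) \<Rightarrow> 'v \<Rightarrow> (nat \<Rightarrow> 'v) \<Rightarrow> 'k" where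
  "bal_right_action \<phi> h = (\<lambda>g. fibre_action (inv_into UNIV h) (\<phi> (g \<circ> inv_into UNIV h)))"

text \<open>The invariants are the \<open>\<phi>\<close> with \<open>\<phi>(gh) = h\<^sup>-\<^sup>1 \<phi>(g)\<close>; see \<open>bal_invariants_iff\<close> below.\<close>

definition bal_invariants :: "'v \<Rightarrow> nat \<Rightarrow> (('v \<Rightarrow> 'v) \<Rightarrow> 'v \<Rightarrow> (nat \<Rightarrow> 'v) \<Rightarrow> 'k) set" where
  "bal_invariants v0 p =
     {\<phi> \<in> bal_tensor v0 p. \<forall>h\<in>line_stabilizer v0. bal_right_action \<phi> h = \<phi>}"


definition coaction :: "((nat \<Rightarrow> 'v) \<Rightarrow> 'k) \<Rightarrow> ('v \<Rightarrow> 'v) \<Rightarrow> (nat \<Rightarrow> 'v) \<Rightarrow> 'k" where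
  "coaction \<xi> = (\<lambda>g x. if g \<in> GL then \<xi> (g \<circ> x) else 0)"

text \<open>Dual of the map \<open>[v0] \<otimes> \<Lambda>\<^sup>p (V/[v0]) \<rightarrow> \<Lambda>\<^sup>p\<^sup>+\<^sup>1 V\<close>, \<open>u \<otimes> x\<^sub>0 \<and> x\<^sub>1 \<and> \<dots> \<mapsto> u \<and> x\<^sub>0 \<and> x\<^sub>1 \<and> \<dots>\<close>.\<close>

definition ext_product_dual :: "'v \<Rightarrow> ((nat \<Rightarrow> 'v) \<Rightarrow> 'k) \<Rightarrow> 'v \<Rightarrow> (nat \<Rightarrow> 'v) \<Rightarrow> 'k" where
  "ext_product_dual v0 \<xi> = (\<lambda>u x. if u \<in> line v0 then \<xi> (case_nat u x) else 0)"

definition psi :: "'v \<Rightarrow> ((nat \<Rightarrow> 'v) \<Rightarrow> 'k) \<Rightarrow> ('v \<Rightarrow> 'v) \<Rightarrow> 'v \<Rightarrow> (nat \<Rightarrow> 'v) \<Rightarrow> 'k" where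
  "psi v0 \<xi> = (\<lambda>g. ext_product_dual v0 (coaction \<xi> g))"


definition form_action :: "('v \<Rightarrow> 'v) \<Rightarrow> ((nat \<Rightarrow> 'v) \<Rightarrow> 'k) \<Rightarrow> (nat \<Rightarrow> 'v) \<Rightarrow> 'k" where
  "form_action g \<xi> = (\<lambda>x. \<xi> (inv_into UNIV g \<circ> x))"

text \<open>
  Translation of sections of \<open>\<Omega>\<^sup>p(m)\<close>: \<open>g\<^sup>-\<^sup>1\<close> maps the chart \<open>{v. l v = 1}\<close> to
  \<open>{v. (l \<circ> g) v = 1}\<close>, and the trivializing section \<open>(l \<circ> g)\<^sup>m\<close> pulls back to \<open>l\<^sup>m\<close>.
\<close>

definition section_action ::
    "('v \<Rightarrow> 'v) \<Rightarrow> (('v \<Rightarrow> 'k) \<Rightarrow> 'v \<Rightarrow> (nat \<Rightarrow> 'v) \<Rightarrow> 'k) \<Rightarrow> ('v \<Rightarrow> 'k) \<Rightarrow> 'v \<Rightarrow> (nat \<Rightarrow> 'v) \<Rightarrow> 'k" where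
  "section_action g s = (\<lambda>l v x. s (l \<circ> g) (inv_into UNIV g v) (inv_into UNIV g \<circ> x))"

definition left_translation ::
    "('v \<Rightarrow> 'v) \<Rightarrow> (('v \<Rightarrow> 'v) \<Rightarrow> 'v \<Rightarrow> (nat \<Rightarrow> 'v) \<Rightarrow> 'k) \<Rightarrow> ('v \<Rightarrow> 'v) \<Rightarrow> 'v \<Rightarrow> (nat \<Rightarrow> 'v) \<Rightarrow> 'k" where
  "left_translation g \<phi> = (\<lambda>g'. \<phi> (inv_into UNIV g \<circ> g'))"

text \<open>
  The fibre of \<open>\<Omega>\<^sup>p(p + 1)\<close> at \<open>[v0]\<close> is \<open>L \<otimes> \<Lambda>\<^sup>p W\<close>: the tangent space at \<open>[v0]\<close> is
  \<open>Hom([v0], V/[v0])\<close>, so the fibre of \<open>\<Omega>\<^sup>p\<close> is \<open>[v0]\<^sup>p \<otimes> \<Lambda>\<^sup>p (V/[v0])\<^sup>\<or>\<close>, and that of \<open>O(p + 1)\<close> is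
  \<open>L\<^sup>p\<^sup>+\<^sup>1\<close>.  For \<open>u \<noteq> 0\<close> in \<open>[v0]\<close> the derivative at \<open>u\<close> of \<open>V - 0 \<rightarrow> \<P>V\<close> is the composition
  \<open>V \<rightarrow> V/[v0] \<rightarrow> Hom([v0], V/[v0])\<close> whose second map sends \<open>w\<close> to the homomorphism \<open>u \<mapsto> w\<close>.
\<close>

definition fibre_value ::
    "'v \<Rightarrow> (('v \<Rightarrow> 'k) \<Rightarrow> 'v \<Rightarrow> (nat \<Rightarrow> 'v) \<Rightarrow> 'k) \<Rightarrow> 'v \<Rightarrow> (nat \<Rightarrow> 'v) \<Rightarrow> 'k" where
  "fibre_value v0 s = (\<lambda>u x. if u \<in> line v0 \<and> u \<noteq> 0 then cone_value s u x else 0)"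

text \<open>
  A section \<open>s\<close> of a homogeneous bundle \<open>GL(V) \<times>\<^sub>H M\<close> corresponds to the equivariant map whose
  value at \<open>g\<close> is \<open>g\<^sup>-\<^sup>1 s(g[v0])\<close>, the value of \<open>g\<^sup>-\<^sup>1 s\<close> at \<open>[v0]\<close>.
\<close>

definition bundle_description ::
    "'v \<Rightarrow> (('v \<Rightarrow> 'k) \<Rightarrow> 'v \<Rightarrow> (nat \<Rightarrow> 'v) \<Rightarrow> 'k) \<Rightarrow> ('v \<Rightarrow> 'v) \<Rightarrow> 'v \<Rightarrow> (nat \<Rightarrow> 'v) \<Rightarrow> 'k" where
  "bundle_description v0 s =
     (\<lambda>g. if g \<in> GL then fibre_value v0 (section_action (inv_into UNIV g) s) else 0)"

text \<open>
  Isomorphism of \<open>GL(V)\<close>-modules between \<open>M\<close> and \<open>N\<close>, with given scalar multiplications and actions.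
\<close>

definition GL_module_iso ::
    "'a::plus set \<Rightarrow> ('k \<Rightarrow> 'a \<Rightarrow> 'a) \<Rightarrow> (('v \<Rightarrow> 'v) \<Rightarrow> 'a \<Rightarrow> 'a) \<Rightarrow>
     'b::plus set \<Rightarrow> ('k \<Rightarrow> 'b \<Rightarrow> 'b) \<Rightarrow> (('v \<Rightarrow> 'v) \<Rightarrow> 'b \<Rightarrow> 'b) \<Rightarrow> ('a \<Rightarrow> 'b) \<Rightarrow> bool" where
  "GL_module_iso M sM aM N sN aN f \<longleftrightarrow>
     bij_betw f M N \<and>
     (\<forall>x\<in>M. \<forall>y\<in>M. f (x + y) = f x + f y) \<and>
     (\<forall>c. \<forall>x\<in>M. f (sM c x) = sN c (f x)) \<and>
     (\<forall>g\<in>GL. \<forall>x\<in>M. f (aM g x) = aN g (f x))"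

end

definition scale_form :: "'k::field_char_0 \<Rightarrow> ('t \<Rightarrow> 'k) \<Rightarrow> 't \<Rightarrow> 'k" where
  "scale_form c \<xi> = (\<lambda>x. c * \<xi> x)"

definition scale_map :: "'k::field_char_0 \<Rightarrow> ('r \<Rightarrow> 's \<Rightarrow> 't \<Rightarrow> 'k) \<Rightarrow> 'r \<Rightarrow> 's \<Rightarrow> 't \<Rightarrow> 'k" where
  "scale_map c \<phi> = (\<lambda>g u x. c * \<phi> g u x)"


text \<open>\<open>\<xi>\<^sub>1 \<and> \<dots> \<and> \<xi>\<^sub>q\<close> as an alternating form, via \<open>\<Lambda>\<^sup>q V\<^sup>\<or> = (\<Lambda>\<^sup>q V)\<^sup>\<or>\<close>.\<close>

definition wedge :: "('v \<Rightarrow> 'k::comm_ring_1) list \<Rightarrow> (nat \<Rightarrow> 'v) \<Rightarrow> 'k" where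
  "wedge fs x = det (mat (length fs) (length fs) (\<lambda>(i, j). (fs ! i) (x j)))"

lemma koszul_wedge:
  fixes fs :: "('v::ab_group_add \<Rightarrow> 'k::field_char_0) list"
  shows "koszul (length fs) (\<lambda>v x. wedge fs x * f v) =
    (\<lambda>v x. \<Sum>i<length fs. (-1) ^ i * wedge (take i fs @ drop (Suc i) fs) x * ((fs ! i) v * f v))"
proof (intro ext)
  fix v x
  let ?n = "length fs"
  show "koszul ?n (\<lambda>v x. wedge fs x * f v) v x =
    (\<Sum>i<?n. (-1) ^ i * wedge (take i fs @ drop (Suc i) fs) x * ((fs ! i) v * f v))"
  proof (cases "?n = 0")
    case True
    then show ?thesis by (simp add: koszul_def)
  next
    case False
    let ?A = "mat ?n ?n (\<lambda>(i, j). (fs ! i) (case_nat v x j))"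
    have minor: "det (mat_delete ?A i 0) = wedge (take i fs @ drop (Suc i) fs) x"
      if "i < ?n" for i
    proof -
      have "mat_delete ?A i 0 = mat (?n - 1) (?n - 1)
          (\<lambda>(a, b). ((take i fs @ drop (Suc i) fs) ! a) (x b))"
        using that by (intro eq_matI) (auto simp: mat_delete_def nth_append min_def)
      moreover have "length (take i fs @ drop (Suc i) fs) = ?n - 1" using that by simp
      ultimately show ?thesis by (simp only: wedge_def)
    qed
    have "det ?A = (\<Sum>i<?n. ?A $$ (i, 0) * cofactor ?A i 0)"
      using False by (intro laplace_expansion_column) auto
    also have "\<dots> = (\<Sum>i<?n. (fs ! i) v * ((-1) ^ i * wedge (take i fs @ drop (Suc i) fs) x))"
      using False minor by (intro sum.cong) (auto simp: cofactor_def)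
    finally have "det ?A * f v = (\<Sum>i<?n. (-1) ^ i * wedge (take i fs @ drop (Suc i) fs) x * ((fs ! i) v * f v))"
      by (simp only: sum_distrib_left mult_ac)
    then show ?thesis
      using False by (simp add: koszul_def wedge_def del: length_0_conv)
  qed
qed

lemma bal_invariants_iff:
  fixes scale :: "'k::field_char_0 \<Rightarrow> 'v::ab_group_add \<Rightarrow> 'v"
  assumes "vector_space scale"
  shows "\<phi> \<in> bal_invariants scale v0 p \<longleftrightarrow> \<phi> \<in> bal_tensor scale v0 p \<and>
    (\<forall>g\<in>GL scale. \<forall>h\<in>line_stabilizer scale v0. \<phi> (g \<circ> h) = fibre_action (inv_into UNIV h) (\<phi> g))"
proof -
  interpret vector_space scale by fact
  have GL_comp: "g \<circ> h \<in> GL scale" if "g \<in> GL scale" "h \<in> GL scale" for g h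
    using that by (auto simp: GL_def intro: Vector_Spaces.linear_compose bij_comp)
  have GL_inv: "inv_into UNIV h \<in> GL scale" if "h \<in> GL scale" for h
  proof -
    have lin: "Vector_Spaces.linear scale scale h" and "bij h" using that by (auto simp: GL_def)
    interpret h: Vector_Spaces.linear scale scale h by fact
    have b: "h (inv_into UNIV h x) = x" "inv_into UNIV h (h x) = x" for x
      using \<open>bij h\<close> by (auto simp: bij_is_surj surj_f_inv_f bij_is_inj)
    have "inv_into UNIV h (x + y) = inv_into UNIV h x + inv_into UNIV h y" "inv_into UNIV h (scale c x) = scale c (inv_into UNIV h x)" for x y c
      by (metis b h.add, metis b h.scale)
    then show ?thesis
      using \<open>bij h\<close> vector_space_axioms
      by (auto simp: GL_def bij_imp_bij_inv Vector_Spaces.linear_iff)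
  qed
  have sGL: "h \<in> GL scale" if "h \<in> line_stabilizer scale v0" for h
    using that by (simp add: line_stabilizer_def)
  have GL_cancel: "h \<circ> inv_into UNIV h = id" "inv_into UNIV h \<circ> h = id" if "h \<in> GL scale" for h
    using that by (auto simp: GL_def bij_is_surj surj_f_inv_f bij_is_inj fun_eq_iff)
  have "(bal_right_action \<phi> h = \<phi>) \<longleftrightarrow>
      (\<forall>g\<in>GL scale. \<phi> (g \<circ> h) = fibre_action (inv_into UNIV h) (\<phi> g))"
    if \<phi>: "\<phi> \<in> bal_tensor scale v0 p" and h: "h \<in> GL scale" for h
  proof
    assume *: "bal_right_action \<phi> h = \<phi>"
    show "\<forall>g\<in>GL scale. \<phi> (g \<circ> h) = fibre_action (inv_into UNIV h) (\<phi> g)"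
    proof
      fix g
      have "bal_right_action \<phi> h (g \<circ> h) = fibre_action (inv_into UNIV h) (\<phi> g)"
        by (simp add: bal_right_action_def comp_assoc GL_cancel[OF h])
      with * show "\<phi> (g \<circ> h) = fibre_action (inv_into UNIV h) (\<phi> g)" by simp
    qed
  next
    assume *: "\<forall>g\<in>GL scale. \<phi> (g \<circ> h) = fibre_action (inv_into UNIV h) (\<phi> g)"
    show "bal_right_action \<phi> h = \<phi>"
    proof
      fix g
      show "bal_right_action \<phi> h g = \<phi> g"
      proof (cases "g \<in> GL scale")
        case True
        have "\<phi> ((g \<circ> inv_into UNIV h) \<circ> h) = fibre_action (inv_into UNIV h) (\<phi> (g \<circ> inv_into UNIV h))"
          using * GL_comp[OF True GL_inv[OF h]] by blast
        then show ?thesis by (simp add: bal_right_action_def comp_assoc GL_cancel[OF h])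
      next
        case False
        have "g \<circ> inv_into UNIV h \<notin> GL scale"
        proof
          assume "g \<circ> inv_into UNIV h \<in> GL scale"
          from GL_comp[OF this h] False show False by (simp add: comp_assoc GL_cancel[OF h])
        qed
        then have "\<phi> (g \<circ> inv_into UNIV h) = 0" "\<phi> g = 0" using \<phi> False by (auto simp: bal_tensor_def)
        then show ?thesis by (simp add: bal_right_action_def fibre_action_def fun_eq_iff)
      qed
    qed
  qed
  then show ?thesis unfolding bal_invariants_def using sGL by blast
qed

end

theory Submission
  imports Defs
begin

text \<open>
  Everything is expressed through the form \<open>\<xi>\<close> itself: the section of \<open>\<Omega>\<^sup>p(p + 1)\<close> attached to \<open>\<xi>\<close> has
  the value \<open>\<xi>(v, x)\<close> on every chart, and evaluating it along \<open>g\<close> gives \<open>\<xi>(g u, g x) = \<psi>(\<xi>)(g)\<close>, so the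
  proportionality constant is 1.  Conversely, a section, as well as an equivariant map
  on \<open>GL(V)\<close>, gives a function \<open>\<eta> v x\<close> on \<open>V - 0\<close> which is homogeneous of degree 1 in \<open>v\<close>,
  alternating in \<open>x\<close> and zero when some \<open>x i\<close> is \<open>v\<close>.  Regularity makes it polynomial on affine lines
  missing the origin, and this with homogeneity already forces linearity in \<open>v\<close>.  Hence \<open>\<eta> v x\<close> lies
  in the Koszul kernel and comes from a unique \<open>\<xi>\<close>.
\<close>

subsection \<open>Polynomial functions on lines\<close>

text \<open>Regularity is only given chart by chart, or through the group, and extending
  \<open>\<eta>\<close> over the origin would normally call for a Hartogs argument. Affine lines
  avoid it. If \<open>u\<close> is not in \<open>span {w}\<close>, some linear form has
  \<open>l u = 1\<close> and \<open>l w = 0\<close>, so all of \<open>u + t *s w\<close> lies in the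
  one chart \<open>l = 1\<close>. The degree of \<open>\<eta>\<close> in \<open>v\<close> is 1
  because pulling a \<open>p\<close>-form back to the cone gives degree \<open>-p\<close> and the
  twist gives \<open>p + 1\<close>. Characteristic zero enters where polynomials are identified with
  functions and where an equation is divided by 2.\<close>

definition polynomial_map :: "('k::field_char_0 \<Rightarrow> 'k) \<Rightarrow> bool" where
  "polynomial_map f \<longleftrightarrow> (\<exists>q. f = poly q)"

lemma polynomial_map_const: "polynomial_map (\<lambda>t. c)"
  unfolding polynomial_map_def by (intro exI[of _ "[:c:]"]) auto

lemma polynomial_map_id: "polynomial_map (\<lambda>t. t)"
  unfolding polynomial_map_def by (intro exI[of _ "[:0, 1:]"]) auto

lemma polynomial_map_add: "polynomial_map f \<Longrightarrow> polynomial_map g \<Longrightarrow> polynomial_map (\<lambda>t. f t + g t)"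
  unfolding polynomial_map_def by (auto simp: fun_eq_iff simp flip: poly_add)

lemma polynomial_map_mult: "polynomial_map f \<Longrightarrow> polynomial_map g \<Longrightarrow> polynomial_map (\<lambda>t. f t * g t)"
  unfolding polynomial_map_def by (auto simp: fun_eq_iff simp flip: poly_mult)

lemmas polynomial_map_intros =
  polynomial_map_const polynomial_map_id polynomial_map_add polynomial_map_mult

text \<open>With \<open>n = degree b\<close>, multiplying by \<open>t ^ n\<close> turns
  \<open>b\<close> at the inverse of \<open>t\<close> into the reflected polynomial, so
  \<open>t ^ n * a\<close> is \<open>t\<close> times a polynomial of degree at most
  \<open>n\<close>.\<close>

lemma degree_le_1_of_reciprocal:
  fixes a b :: "'k::field_char_0 poly"
  assumes "\<And>t. t \<noteq> 0 \<Longrightarrow> poly a t = t * poly b (inverse t)"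
  shows "degree a \<le> 1"
proof (cases "a = 0")
  case False
  let ?n = "degree b"
  \<comment> \<open>The extra factor \<open>[:0, 1:]\<close> makes both sides vanish at
    \<open>t = 0\<close>, about which the hypothesis is silent; it is cancelled afterwards.\<close>
  have "poly ([:0, 1:] * (monom 1 ?n * a)) t = poly ([:0, 1:] * ([:0, 1:] * reflect_poly b)) t" for t
    using assms[of t] by (cases "t = 0") (auto simp: poly_monom poly_reflect_poly_nz)
  then have "[:0, 1:] * (monom 1 ?n * a) = [:0, 1:] * ([:0, 1:] * reflect_poly b)"
    using poly_eq_poly_eq_iff by blast
  then have eq: "monom 1 ?n * a = [:0, 1:] * reflect_poly b" by (subst (asm) mult_left_cancel) auto
  have "?n + degree a = degree (monom 1 ?n * a)"
    using False by (subst degree_mult_eq) (auto simp: degree_monom_eq)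
  also have "\<dots> \<le> degree [:0, 1::'k:] + degree (reflect_poly b)"
    unfolding eq by (rule degree_mult_le)
  also have "\<dots> \<le> 1 + ?n" using degree_reflect_poly_le[of b] by simp
  finally show ?thesis by simp
qed auto

text \<open>Both polynomials have degree at most 1, and the relation swaps their two coefficients.
  In the application \<open>a\<close> and \<open>b\<close> are one homogeneous function along
  \<open>u + t *s w\<close> and \<open>w + t *s u\<close>, and the conclusion is its
  additivity.\<close>

lemma reciprocal_at_1:
  fixes a b :: "'k::field_char_0 poly"
  assumes ab: "\<And>t. t \<noteq> 0 \<Longrightarrow> poly a t = t * poly b (inverse t)"
  shows "poly a 1 = poly a 0 + poly b 0"
proof -
  have ba: "poly b t = t * poly a (inverse t)" if "t \<noteq> 0" for t
    using ab[of "inverse t"] that by auto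
  have linear: "\<exists>c d. q = [:c, d:]" if "degree q \<le> 1" for q :: "'k poly"
    using that by (intro exI[of _ "coeff q 0"] exI[of _ "coeff q 1"] poly_eqI)
      (auto simp: coeff_pCons coeff_eq_0 split: nat.split)
  obtain a0 a1 b0 b1 where a: "a = [:a0, a1:]" and b: "b = [:b0, b1:]"
    using linear[OF degree_le_1_of_reciprocal[OF ab]] linear[OF degree_le_1_of_reciprocal[OF ba]]
    by blast
  have "a0 + a1 = b0 + b1" using ab[of 1] by (simp add: a b)
  moreover have "a0 - a1 = b1 - b0" using ab[of "-1"] by (simp add: a b)
  ultimately have "(a0 + a1) - (a0 - a1) = (b0 + b1) - (b1 - b0)" by simp
  then have "2 * a1 = 2 * b0" by (simp add: algebra_simps)
  then show ?thesis by (simp add: a b)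
qed

section \<open>Linear forms and the general linear group\<close>

locale fin_dim_char_0_space = finite_dimensional_vector_space scale Basis
  for scale :: "'k::field_char_0 \<Rightarrow> 'v::ab_group_add \<Rightarrow> 'v"  (infixr "*s" 75) and Basis
begin

lemma dual_pair: "vector_space_pair scale ((*) :: 'k \<Rightarrow> 'k \<Rightarrow> 'k)"
  by unfold_locales (auto simp: algebra_simps)

lemma dual_space_iff:
  "f \<in> dual_space scale \<longleftrightarrow> (\<forall>x y. f (x + y) = f x + f y) \<and> (\<forall>c x. f (c *s x) = c * f x)"
  using dual_pair by (auto simp: dual_space_def Vector_Spaces.linear_iff vector_space_pair_def)

lemma
  assumes "f \<in> dual_space scale"
  shows dual_add: "f (x + y) = f x + f y" and dual_scale: "f (c *s x) = c * f x"
    and dual_zero: "f 0 = 0" and dual_diff: "f (x - y) = f x - f y" and dual_minus: "f (- x) = - f x"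
proof -
  show *: "f (x + y) = f x + f y" "f (c *s x) = c * f x" for x y c
    using assms by (auto simp: dual_space_iff)
  show "f 0 = 0" using *(2)[of 0 0] by simp
  show diff: "f (x - y) = f x - f y" for x y using *(1)[of "x - y" y] by simp
  show "f (- x) = - f x" using diff[of 0 x] \<open>f 0 = 0\<close> by simp
qed

lemma GL_iff:
  "g \<in> GL scale \<longleftrightarrow> (\<forall>x y. g (x + y) = g x + g y) \<and> (\<forall>c x. g (c *s x) = c *s g x) \<and> bij g"
  using vector_space_axioms by (auto simp: GL_def Vector_Spaces.linear_iff)

lemma
  assumes "g \<in> GL scale"
  shows GL_add: "g (x + y) = g x + g y" and GL_scale: "g (c *s x) = c *s g x"
    and GL_linear: "Vector_Spaces.linear scale scale g"
    and GL_inv_left: "inv_into UNIV g (g x) = x" and GL_inv_right: "g (inv_into UNIV g x) = x"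
    and GL_inv_inv: "inv_into UNIV (inv_into UNIV g) = g"
  using assms assms[unfolded GL_iff]
  by (auto simp: GL_def bij_is_inj bij_is_surj surj_f_inv_f inv_inv_eq)

lemma GL_diff: "g \<in> GL scale \<Longrightarrow> g (x - y) = g x - g y"
  using GL_add[of g "x - y" y] by simp

lemma GL_comp: "g \<in> GL scale \<Longrightarrow> h \<in> GL scale \<Longrightarrow> g \<circ> h \<in> GL scale"
  by (auto simp: GL_iff bij_comp)

lemma GL_inv:
  assumes "g \<in> GL scale" shows "inv_into UNIV g \<in> GL scale"
  unfolding GL_iff
proof (intro conjI allI)
  show "inv_into UNIV g (x + y) = inv_into UNIV g x + inv_into UNIV g y" for x y
    by (metis GL_add GL_inv_left GL_inv_right assms)
  show "inv_into UNIV g (c *s x) = c *s inv_into UNIV g x" for c x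
    by (metis GL_scale GL_inv_left GL_inv_right assms)
  show "bij (inv_into UNIV g)" using assms by (simp add: GL_iff bij_imp_bij_inv)
qed

lemma GL_inv_comp: "g \<in> GL scale \<Longrightarrow> h \<in> GL scale \<Longrightarrow>
    inv_into UNIV (g \<circ> h) = inv_into UNIV h \<circ> inv_into UNIV g"
  by (simp add: GL_def o_inv_distrib)

lemma GLI:
  assumes "\<And>x y. g (x + y) = g x + g y" "\<And>c x. g (c *s x) = c *s g x"
    and "\<And>x. g' (g x) = x" "\<And>x. g (g' x) = x"
  shows "g \<in> GL scale" "inv_into UNIV g = g'"
proof -
  have "bij g" using assms(3,4) by (intro o_bij[of g']) auto
  then show "g \<in> GL scale" using assms by (auto simp: GL_iff)
  show "inv_into UNIV g = g'" using assms(3,4) by (intro inv_unique_comp) auto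
qed

text \<open>Supplies the chart \<open>l = 1\<close> that contains the whole line
  \<open>u + t *s w\<close>.\<close>

lemma dual_separates:
  assumes "u \<notin> span {w}"
  obtains l where "l \<in> dual_space scale" "l u = 1" "l w = 0"
proof -
  have "independent (if w = 0 then {u} else {u, w})"
    using assms by (auto simp: independent_insert dependent_single intro: span_base)
  from vector_space_pair.linear_independent_extend[OF dual_pair this, of "\<lambda>x. if x = u then 1 else 0"]
  obtain l where l: "Vector_Spaces.linear scale (*) l"
    "\<forall>x\<in>(if w = 0 then {u} else {u, w}). l x = (if x = u then 1 else 0)" by blast
  then have "l \<in> dual_space scale" by (simp add: dual_space_def)
  moreover have "u \<noteq> w" using assms span_base by blast
  ultimately show thesis using l(2) dual_zero[of l] by (intro that[of l]) (auto split: if_splits)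
qed

lemma dual_nonzero:
  assumes "u \<noteq> 0"
  obtains l where "l \<in> dual_space scale" "l u = 1"
  using dual_separates[of u 0] assms by auto

lemma dual_comp_GL:
  assumes "g \<in> GL scale" shows "l \<circ> g \<in> dual_space scale \<longleftrightarrow> l \<in> dual_space scale"
proof
  assume "l \<circ> g \<in> dual_space scale"
  then have "(l \<circ> g) \<circ> inv_into UNIV g \<in> dual_space scale"
    using GL_inv[OF assms] by (auto simp: dual_space_iff GL_iff)
  then show "l \<in> dual_space scale" by (simp add: comp_def GL_inv_right[OF assms])
qed (use assms in \<open>auto simp: dual_space_iff GL_iff\<close>)

text \<open>Since \<open>l w\<close> may be nonzero, this covers every perturbation of the identity
  of rank at most one. Transitivity uses the general case; \<open>l w = 0\<close> gives additive
  one-parameter groups.\<close>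

definition transvection :: "('v \<Rightarrow> 'k) \<Rightarrow> 'v \<Rightarrow> 'v \<Rightarrow> 'v" where
  "transvection l w x = x + l x *s w"

text \<open>Sherman-Morrison formula: composing the perturbations by \<open>a *s w\<close> and
  \<open>b *s w\<close> gives the coefficient \<open>a + b + a * b * l w\<close>, symmetric in
  \<open>a\<close> and \<open>b\<close>, which vanishes for \<open>a = 1\<close> and
  \<open>b = - inverse (1 + l w)\<close>.\<close>

lemma
  assumes l: "l \<in> dual_space scale" and nz: "1 + l w \<noteq> 0"
  shows transvection_GL: "transvection l w \<in> GL scale"
    and inv_transvection: "inv_into UNIV (transvection l w) = transvection l (- inverse (1 + l w) *s w)"
proof -
  have lin: "transvection l w (x + y) = transvection l w x + transvection l w y"
    "transvection l w (c *s x) = c *s transvection l w x" for x y c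
    by (simp_all add: transvection_def dual_add[OF l] dual_scale[OF l] scale_left_distrib
        scale_right_distrib)
  have comp: "transvection l (b *s w) (transvection l (a *s w) x) = x + (l x * (a + b + a * b * l w)) *s w"
    for a b x
    by (simp add: transvection_def dual_add[OF l] dual_scale[OF l] algebra_simps)
  have "1 + - inverse (1 + l w) + 1 * (- inverse (1 + l w)) * l w = 0"
    "- inverse (1 + l w) + 1 + (- inverse (1 + l w)) * 1 * l w = 0"
    using nz by (simp_all add: divide_simps)
  with comp[of "- inverse (1 + l w)" 1] comp[of 1 "- inverse (1 + l w)"]
  have inv: "transvection l (- inverse (1 + l w) *s w) (transvection l w x) = x"
    "transvection l w (transvection l (- inverse (1 + l w) *s w) x) = x" for x
    by simp_all
  show "transvection l w \<in> GL scale" by (rule GLI(1)[OF lin inv])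
  show "inv_into UNIV (transvection l w) = transvection l (- inverse (1 + l w) *s w)"
    by (rule GLI(2)[OF lin inv])
qed

text \<open>One rank-one perturbation suffices once a form \<open>l\<close> is nonzero at both
  vectors: for \<open>w = inverse (l u) *s (v - u)\<close> the quantity \<open>1 + l w\<close> is
  the quotient of \<open>l v\<close> by \<open>l u\<close>.\<close>

lemma GL_transitive:
  assumes "u \<noteq> 0" "v \<noteq> 0"
  obtains g where "g \<in> GL scale" "g u = v"
proof -
  obtain l where l: "l \<in> dual_space scale" "l u \<noteq> 0" "l v \<noteq> 0"
  proof -
    obtain l1 where l1: "l1 \<in> dual_space scale" "l1 u = 1" using dual_nonzero assms by blast
    obtain l2 where l2: "l2 \<in> dual_space scale" "l2 v = 1" using dual_nonzero assms by blast
    have "(\<lambda>x. l1 x + l2 x) \<in> dual_space scale"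
      using l1 l2 by (auto simp: dual_space_iff algebra_simps)
    \<comment> \<open>If \<open>l1\<close> vanishes at \<open>v\<close> and \<open>l2\<close> at
      \<open>u\<close>, their sum takes the value 1 at both vectors.\<close>
    then show thesis using that[of l1] that[of l2] that[of "\<lambda>x. l1 x + l2 x"] l1 l2
      by (cases "l1 v = 0"; cases "l2 u = 0") auto
  qed
  let ?w = "inverse (l u) *s (v - u)"
  have "1 + l ?w \<noteq> 0" using l by (simp add: dual_scale dual_diff field_simps)
  moreover have "transvection l ?w u = v" using l by (simp add: transvection_def)
  ultimately show thesis using transvection_GL[OF l(1), of ?w] that by blast
qed

lemma line_iff: "x \<in> line scale v0 \<longleftrightarrow> (\<exists>c. x = c *s v0)"
  by (auto simp: line_def span_singleton)

lemma scale_self_line: "v0 \<in> line scale v0" and zero_line: "0 \<in> line scale v0"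
  by (auto simp: line_def span_base span_zero)

section \<open>Polynomial functions on V, and linearity from homogeneity\<close>

lemma poly_fun_line:
  assumes "poly_fun scale P" shows "polynomial_map (\<lambda>t. P (u + t *s w))"
  using assms
proof induction
  case (poly_fun_dual f)
  then show ?case by (simp add: dual_add dual_scale polynomial_map_intros)
qed (auto intro: polynomial_map_intros)

text \<open>Restricted to the plane spanned by \<open>u\<close> and \<open>w\<close>, \<open>F\<close> is \<open>(a, b) \<mapsto> a A(b/a) = b B(a/b)\<close>
  with polynomials \<open>A\<close> and \<open>B\<close>, which forces both to have degree at most 1.\<close>

lemma homogeneous_polynomial_on_lines_dual:
  assumes hom: "\<And>c v. F (c *s v) = c * F v"
    and lines: "\<And>u w. u \<notin> span {w} \<Longrightarrow> polynomial_map (\<lambda>t. F (u + t *s w))"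
  shows "F \<in> dual_space scale"
  unfolding dual_space_iff
proof (intro conjI allI hom)
  fix u w
  consider c where "u = c *s w" | c where "w = c *s u" | "u \<notin> span {w}" "w \<notin> span {u}"
    by (auto simp: span_singleton)
  then show "F (u + w) = F u + F w"
  proof cases
    case 1
    then show ?thesis using hom[of "c + 1" w] by (simp add: hom algebra_simps)
  next
    case 2
    then show ?thesis using hom[of "1 + c" u] by (simp add: hom algebra_simps)
  next
    case 3
    obtain a b where a: "\<And>t. F (u + t *s w) = poly a t" and b: "\<And>t. F (w + t *s u) = poly b t"
      using lines[OF 3(1)] lines[OF 3(2)] unfolding polynomial_map_def fun_eq_iff by blast
    have "poly a t = t * poly b (inverse t)" if "t \<noteq> 0" for t
    proof -
      have "t *s (w + inverse t *s u) = u + t *s w" using that by (simp add: algebra_simps)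
      then show ?thesis using hom[of t] a b by metis
    qed
    from reciprocal_at_1[OF this] show ?thesis using a[of 1] a[of 0] b[of 0] by simp
  qed
qed

text \<open>First-order Taylor expansion at the origin: the linear form is the differential there
  and must be the same for all \<open>v\<close>; the remainder may vary with \<open>v\<close>, hence
  the order of quantifiers.\<close>

lemma poly_fun_along_ray:
  assumes "poly_fun scale P"
  shows "\<exists>a. \<exists>l\<in>dual_space scale. \<forall>v. \<exists>r. \<forall>t. P (t *s v) = a + t * l v + t\<^sup>2 * poly r t"
  using assms
proof induction
  case (poly_fun_const c)
  show ?case
    by (intro exI[of _ c] bexI[of _ "\<lambda>v. 0"] allI exI[of _ 0]) (auto simp: dual_space_iff)
next
  case (poly_fun_dual f)
  then show ?case
    by (intro exI[of _ 0] bexI[of _ f] allI exI[of _ 0]) (auto simp: dual_scale)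
next
  case (poly_fun_add P Q)
  then obtain a l b m where l: "l \<in> dual_space scale" "m \<in> dual_space scale"
    "\<forall>v. \<exists>r. \<forall>t. P (t *s v) = a + t * l v + t\<^sup>2 * poly r t"
    "\<forall>v. \<exists>r. \<forall>t. Q (t *s v) = b + t * m v + t\<^sup>2 * poly r t" by metis
  have "\<exists>s. \<forall>t. P (t *s v) + Q (t *s v) = (a + b) + t * (l v + m v) + t\<^sup>2 * poly s t" for v
  proof -
    from l(3,4) obtain r s where "\<forall>t. P (t *s v) = a + t * l v + t\<^sup>2 * poly r t"
      "\<forall>t. Q (t *s v) = b + t * m v + t\<^sup>2 * poly s t" by blast
    then show ?thesis by (intro exI[of _ "r + s"]) (auto simp: algebra_simps)
  qed
  then show ?case using l
    by (intro exI[of _ "a + b"] bexI[of _ "\<lambda>v. l v + m v"]) (auto simp: dual_space_iff algebra_simps)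
next
  case (poly_fun_mult P Q)
  then obtain a l b m where l: "l \<in> dual_space scale" "m \<in> dual_space scale"
    "\<forall>v. \<exists>r. \<forall>t. P (t *s v) = a + t * l v + t\<^sup>2 * poly r t"
    "\<forall>v. \<exists>r. \<forall>t. Q (t *s v) = b + t * m v + t\<^sup>2 * poly r t" by metis
  have "\<exists>s. \<forall>t. P (t *s v) * Q (t *s v) = a * b + t * (a * m v + b * l v) + t\<^sup>2 * poly s t" for v
  proof -
    from l(3,4) obtain r s where "\<forall>t. P (t *s v) = a + t * l v + t\<^sup>2 * poly r t"
      "\<forall>t. Q (t *s v) = b + t * m v + t\<^sup>2 * poly s t" by blast
    then show ?thesis
      \<comment> \<open>The terms of order at least 2 in the product, divided by
        \<open>t\<^sup>2\<close>.\<close>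
      by (intro exI[of _ "[:l v * m v:] + [:a, l v:] * s + [:b, m v:] * r + [:0, 0, 1:] * r * s"])
        (auto simp: algebra_simps power2_eq_square)
  qed
  then show ?case using l
    by (intro exI[of _ "a * b"] bexI[of _ "\<lambda>v. a * m v + b * l v"]) (auto simp: dual_space_iff algebra_simps)
qed

text \<open>Along each ray \<open>P\<close> is \<open>t * P v\<close>; comparing coefficients of
  \<open>t\<close> shows that \<open>P\<close> equals its differential at the origin.\<close>

lemma homogeneous_poly_fun_dual:
  assumes "poly_fun scale P" and hom: "\<And>c v. P (c *s v) = c * P v"
  shows "P \<in> dual_space scale"
proof -
  obtain a l where l: "l \<in> dual_space scale"
    "\<forall>v. \<exists>r. \<forall>t. P (t *s v) = a + t * l v + t\<^sup>2 * poly r t"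
    using poly_fun_along_ray[OF assms(1)] by metis
  have "P v = l v" for v
  proof -
    from l(2) obtain r where r: "\<And>t. P (t *s v) = a + t * l v + t\<^sup>2 * poly r t" by blast
    have "poly [:0, P v:] t = poly (pCons a (pCons (l v) r)) t" for t
      using r[of t] by (simp add: hom algebra_simps power2_eq_square)
    then have "[:0, P v:] = pCons a (pCons (l v) r)" using poly_eq_poly_eq_iff by blast
    then show ?thesis by simp
  qed
  then have "P = l" by auto
  with l(1) show ?thesis by simp
qed

subsection \<open>Alternating forms and the Koszul kernel\<close>

lemma alt_formsI:
  assumes "\<And>x y. (\<And>i. i < q \<Longrightarrow> x i = y i) \<Longrightarrow> \<xi> x = \<xi> y"
    and "\<And>x i. i < q \<Longrightarrow> x i \<notin> U \<Longrightarrow> \<xi> x = 0"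
    and "\<And>x i u w a. i < q \<Longrightarrow> u \<in> U \<Longrightarrow> w \<in> U \<Longrightarrow>
      \<xi> (x(i := a *s u + w)) = a * \<xi> (x(i := u)) + \<xi> (x(i := w))"
    and "\<And>x i j. i < j \<Longrightarrow> j < q \<Longrightarrow> x i = x j \<Longrightarrow> \<xi> x = 0"
  shows "\<xi> \<in> alt_forms scale U q"
  unfolding alt_forms_def using assms by blast

lemma
  assumes "\<xi> \<in> alt_forms scale U q"
  shows alt_forms_cong: "(\<And>i. i < q \<Longrightarrow> x i = y i) \<Longrightarrow> \<xi> x = \<xi> y"
    and alt_forms_outside: "i < q \<Longrightarrow> x i \<notin> U \<Longrightarrow> \<xi> x = 0"
    and alt_forms_lincomb: "i < q \<Longrightarrow> u \<in> U \<Longrightarrow> w \<in> U \<Longrightarrow>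
      \<xi> (x(i := a *s u + w)) = a * \<xi> (x(i := u)) + \<xi> (x(i := w))"
    and alt_forms_alternating: "i \<noteq> j \<Longrightarrow> i < q \<Longrightarrow> j < q \<Longrightarrow> x i = x j \<Longrightarrow> \<xi> x = 0"
proof -
  from assms show "(\<And>i. i < q \<Longrightarrow> x i = y i) \<Longrightarrow> \<xi> x = \<xi> y"
    "i < q \<Longrightarrow> x i \<notin> U \<Longrightarrow> \<xi> x = 0"
    "i < q \<Longrightarrow> u \<in> U \<Longrightarrow> w \<in> U \<Longrightarrow>
      \<xi> (x(i := a *s u + w)) = a * \<xi> (x(i := u)) + \<xi> (x(i := w))"
    unfolding alt_forms_def by blast+
  from assms have "\<And>i j. i < j \<Longrightarrow> j < q \<Longrightarrow> x i = x j \<Longrightarrow> \<xi> x = 0"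
    unfolding alt_forms_def by blast
  then show "i \<noteq> j \<Longrightarrow> i < q \<Longrightarrow> j < q \<Longrightarrow> x i = x j \<Longrightarrow> \<xi> x = 0"
    by (metis linorder_neqE_nat)
qed

lemma alt_forms_zero:
  assumes "\<xi> \<in> alt_forms scale U q" "i < q" and "x i = 0" shows "\<xi> x = 0"
proof (cases "0 \<in> U")
  case True
  have "x(i := 0) = x" using assms(3) by auto
  then show ?thesis using alt_forms_lincomb[OF assms(1,2) True True, of x 1] by simp
qed (use assms alt_forms_outside in metis)

lemma
  assumes "\<xi> \<in> alt_forms scale UNIV q" "i < q"
  shows alt_forms_add: "\<xi> (x(i := u + w)) = \<xi> (x(i := u)) + \<xi> (x(i := w))"
    and alt_forms_scale: "\<xi> (x(i := a *s u)) = a * \<xi> (x(i := u))"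
proof -
  show add: "\<xi> (x(i := u + w)) = \<xi> (x(i := u)) + \<xi> (x(i := w))" for u w
    using alt_forms_lincomb[OF assms, of u w x 1] by simp
  show "\<xi> (x(i := a *s u)) = a * \<xi> (x(i := u))"
    using alt_forms_lincomb[OF assms, of u 0 x a] alt_forms_zero[OF assms, of "x(i := 0)"] by simp
qed

lemma zero_in_alt_forms: "0 \<in> alt_forms scale U q"
  by (rule alt_formsI) auto

lemma alt_forms_restrict:
  assumes \<xi>: "\<xi> \<in> alt_forms scale UNIV q" and U: "subspace U"
  shows "(\<lambda>x. if \<forall>i<q. x i \<in> U then \<xi> x else 0) \<in> alt_forms scale U q"
proof (rule alt_formsI)
  fix x i u w a assume i: "i < q" and uw: "u \<in> U" "w \<in> U"
  \<comment> \<open>\<open>P\<close> concerns the arguments other than the \<open>i\<close>-th; as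
    \<open>u\<close>, \<open>w\<close> and \<open>a *s u + w\<close> all lie in \<open>U\<close>, it
    decides the three conditionals alike.\<close>
  define P where "P \<longleftrightarrow> (\<forall>j<q. j \<noteq> i \<longrightarrow> x j \<in> U)"
  have "(\<forall>j<q. (x(i := z)) j \<in> U) \<longleftrightarrow> P" if "z \<in> U" for z
    using i that by (auto simp: P_def)
  moreover have "a *s u + w \<in> U" using U uw by (simp add: subspace_add subspace_scale)
  ultimately show "(if \<forall>j<q. (x(i := a *s u + w)) j \<in> U then \<xi> (x(i := a *s u + w)) else 0) =
      a * (if \<forall>j<q. (x(i := u)) j \<in> U then \<xi> (x(i := u)) else 0) +
      (if \<forall>j<q. (x(i := w)) j \<in> U then \<xi> (x(i := w)) else 0)"
    using uw alt_forms_lincomb[OF \<xi> i UNIV_I UNIV_I, of x a u w]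
    by (cases P) (simp_all only: if_True if_False mult_zero_right add_0_right)
next
  show "(if \<forall>i<q. x i \<in> U then \<xi> x else 0) = (if \<forall>i<q. y i \<in> U then \<xi> y else 0)"
    if "\<And>i. i < q \<Longrightarrow> x i = y i" for x y
    using that alt_forms_cong[OF \<xi>, of x y] by auto
  show "(if \<forall>i<q. x i \<in> U then \<xi> x else 0) = 0" if "i < j" "j < q" "x i = x j" for x i j
    using that alt_forms_alternating[OF \<xi>, of i j x] by auto
qed auto

lemma alt_forms_plus:
  assumes \<xi>: "\<xi> \<in> alt_forms scale U q" and \<zeta>: "\<zeta> \<in> alt_forms scale U q"
  shows "\<xi> + \<zeta> \<in> alt_forms scale U q"
proof (rule alt_formsI)
  show "(\<xi> + \<zeta>) x = (\<xi> + \<zeta>) y" if "\<And>i. i < q \<Longrightarrow> x i = y i" for x y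
    using alt_forms_cong[OF \<xi> that] alt_forms_cong[OF \<zeta> that] by simp
  show "(\<xi> + \<zeta>) x = 0" if "i < j" "j < q" "x i = x j" for x i j
    using alt_forms_alternating[OF \<xi>, of i j x] alt_forms_alternating[OF \<zeta>, of i j x] that by simp
qed (simp_all add: alt_forms_outside[OF \<xi>] alt_forms_outside[OF \<zeta>]
      alt_forms_lincomb[OF \<xi>] alt_forms_lincomb[OF \<zeta>] distrib_left)

lemma alt_forms_scale_form:
  assumes \<xi>: "\<xi> \<in> alt_forms scale U q" shows "scale_form c \<xi> \<in> alt_forms scale U q"
  unfolding scale_form_def
proof (rule alt_formsI)
  show "c * \<xi> x = c * \<xi> y" if "\<And>i. i < q \<Longrightarrow> x i = y i" for x y
    using alt_forms_cong[OF \<xi> that] by simp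
  show "c * \<xi> x = 0" if "i < j" "j < q" "x i = x j" for x i j
    using alt_forms_alternating[OF \<xi>, of i j x] that by simp
qed (simp_all add: alt_forms_outside[OF \<xi>] alt_forms_lincomb[OF \<xi>] distrib_left mult.left_commute)

lemma alt_forms_pullback:
  assumes \<xi>: "\<xi> \<in> alt_forms scale U q" and T: "Vector_Spaces.linear scale scale T" "range T \<subseteq> U"
  shows "(\<lambda>x. \<xi> (T \<circ> x)) \<in> alt_forms scale UNIV q"
proof (rule alt_formsI)
  interpret T: Vector_Spaces.linear scale scale T by (rule T)
  show "\<xi> (T \<circ> x) = \<xi> (T \<circ> y)" if "\<And>i. i < q \<Longrightarrow> x i = y i" for x y
    using that by (intro alt_forms_cong[OF \<xi>]) simp
  show "\<xi> (T \<circ> x(i := a *s u + w)) = a * \<xi> (T \<circ> x(i := u)) + \<xi> (T \<circ> x(i := w))" if "i < q"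
    for x i u w a
    using alt_forms_lincomb[OF \<xi> that, of "T u" "T w"] T(2)
    by (simp add: fun_upd_comp T.add T.scale image_subset_iff)
  show "\<xi> (T \<circ> x) = 0" if "i < j" "j < q" "x i = x j" for x i j
    using that by (intro alt_forms_alternating[OF \<xi>, of i j]) auto
qed auto

lemma alt_forms_antisymmetric:
  assumes \<xi>: "\<xi> \<in> alt_forms scale UNIV q" and ij: "i \<noteq> j" "i < q" "j < q"
  shows "\<xi> (x(i := u, j := w)) = - \<xi> (x(i := w, j := u))"
proof -
  have alt: "\<xi> (x(i := z, j := z)) = 0" for z
    by (rule alt_forms_alternating[OF \<xi> ij]) (use ij in auto)
  have j: "\<xi> (x(i := z, j := u + w)) = \<xi> (x(i := z, j := u)) + \<xi> (x(i := z, j := w))" for z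
    by (rule alt_forms_add[OF \<xi> ij(3)])
  have i: "\<xi> (x(i := u + w, j := z)) = \<xi> (x(i := u, j := z)) + \<xi> (x(i := w, j := z))" for z
    using alt_forms_add[OF \<xi> ij(2), of "x(j := z)" u w] ij(1) by (simp add: fun_upd_twist)
  have "0 = \<xi> (x(i := u + w, j := u + w))" by (simp add: alt)
  also have "\<dots> = \<xi> (x(i := u, j := w)) + \<xi> (x(i := w, j := u))"
    unfolding i by (simp only: j alt) simp
  finally show ?thesis by (simp add: eq_neg_iff_add_eq_0)
qed

text \<open>The Koszul condition speaks only of position 0, where contraction inserts
  \<open>v\<close>; a transposition brings any other position there at the cost of a sign.\<close>

lemma alt_forms_vanish_at:
  assumes \<xi>: "\<xi> \<in> alt_forms scale UNIV q"
    and first: "\<And>x. 0 < q \<Longrightarrow> x 0 = v \<Longrightarrow> \<xi> x = 0" and k: "k < q" "x k = v"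
  shows "\<xi> x = 0"
proof (cases "k = 0")
  case False
  have "\<xi> x = \<xi> (x(0 := x 0, k := v))" using k by (simp add: fun_upd_idem)
  also have "\<dots> = - \<xi> (x(0 := v, k := x 0))"
    using False k by (intro alt_forms_antisymmetric[OF \<xi>]) auto
  also have "\<dots> = 0" using False k by (simp add: first)
  finally show ?thesis .
qed (use k first in auto)

text \<open>A form that vanishes on \<open>v\<close> descends to the quotient by \<open>[v]\<close>,
  so multiples of \<open>v\<close> are free and only a power of \<open>a\<close> remains. Every
  \<open>chart_deriv\<close> has this shape, which is how changes of chart produce
  \<open>p\<close>-th powers.\<close>

lemma alt_forms_affine:
  assumes \<xi>: "\<xi> \<in> alt_forms scale UNIV q"
    and van: "\<And>x k. k < q \<Longrightarrow> x k = v \<Longrightarrow> \<xi> x = 0"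
  shows "\<xi> (\<lambda>i. a *s x i + b i *s v) = a ^ q * \<xi> x"
proof -
  have "\<xi> (\<lambda>i. if i < n then a *s x i + b i *s v else x i) = a ^ n * \<xi> x" if "n \<le> q" for n
    using that
  proof (induction n)
    case (Suc n)
    let ?y = "\<lambda>i. if i < n then a *s x i + b i *s v else x i"
    have n: "n < q" using Suc.prems by simp
    have "\<xi> (\<lambda>i. if i < Suc n then a *s x i + b i *s v else x i) = \<xi> (?y(n := a *s x n + b n *s v))"
      by (rule arg_cong[of _ _ \<xi>]) (auto simp: less_Suc_eq)
    also have "\<dots> = a * \<xi> (?y(n := x n)) + b n * \<xi> (?y(n := v))"
      by (simp only: alt_forms_lincomb[OF \<xi> n UNIV_I UNIV_I] alt_forms_scale[OF \<xi> n])
    also have "\<xi> (?y(n := v)) = 0" by (rule van[OF n]) simp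
    also have "?y(n := x n) = ?y" by auto
    finally show ?case using Suc by simp
  qed simp
  from this[OF order.refl] have "\<xi> (\<lambda>i. if i < q then a *s x i + b i *s v else x i) = a ^ q * \<xi> x" .
  moreover have "\<xi> (\<lambda>i. if i < q then a *s x i + b i *s v else x i) = \<xi> (\<lambda>i. a *s x i + b i *s v)"
    by (rule alt_forms_cong[OF \<xi>]) simp
  ultimately show ?thesis by simp
qed

text \<open>In a chart and along transvections, the form and its arguments vary with
  \<open>t\<close> simultaneously; multilinear expansion reduces this to fixed arguments. Splitting
  slot \<open>n\<close> replaces \<open>y n\<close> by \<open>z n\<close>, so the induction must
  hold for arbitrary \<open>y\<close>.\<close>

lemma alt_forms_polynomial:
  assumes U: "subspace U" and G: "\<And>t. G t \<in> alt_forms scale U q"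
    and pol: "\<And>x. (\<And>i. i < q \<Longrightarrow> x i \<in> U) \<Longrightarrow> polynomial_map (\<lambda>t. G t x)"
    and y: "\<And>i. i < q \<Longrightarrow> y i \<in> U" and z: "\<And>i. i < q \<Longrightarrow> z i \<in> U"
  shows "polynomial_map (\<lambda>t. G t (\<lambda>i. y i + t *s z i))"
proof -
  have "polynomial_map (\<lambda>t. G t (\<lambda>i. if i < n then y i + t *s z i else y i))"
    if "n \<le> q" "\<And>i. i < q \<Longrightarrow> y i \<in> U" for n and y :: "nat \<Rightarrow> 'v"
    using that
  proof (induction n arbitrary: y)
    case (Suc n)
    have n: "n < q" using Suc.prems by simp
    let ?x = "\<lambda>y t i. if i < n then y i + t *s z i else y i"
    have "G t (\<lambda>i. if i < Suc n then y i + t *s z i else y i)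
        = t * G t (?x (y(n := z n)) t) + G t (?x y t)" for t
    proof -
      have "G t (\<lambda>i. if i < Suc n then y i + t *s z i else y i) = G t ((?x y t)(n := t *s z n + y n))"
        by (rule arg_cong[of _ _ "G t"]) (auto simp: less_Suc_eq)
      also have "\<dots> = t * G t ((?x y t)(n := z n)) + G t ((?x y t)(n := y n))"
        using alt_forms_lincomb[OF G n] Suc.prems(2)[OF n] z[OF n] by simp
      also have "(?x y t)(n := z n) = ?x (y(n := z n)) t" by auto
      also have "(?x y t)(n := y n) = ?x y t" by auto
      finally show ?thesis .
    qed
    moreover have "polynomial_map (\<lambda>t. G t (?x (y(n := z n)) t))" "polynomial_map (\<lambda>t. G t (?x y t))"
      using Suc.prems z n by (intro Suc.IH; auto)+
    ultimately show ?case by (simp add: polynomial_map_intros)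
  qed (simp add: pol)
  from this[OF order.refl y] have "polynomial_map (\<lambda>t. G t (\<lambda>i. if i < q then y i + t *s z i else y i))" .
  moreover have "G t (\<lambda>i. if i < q then y i + t *s z i else y i) = G t (\<lambda>i. y i + t *s z i)" for t
    by (rule alt_forms_cong[OF G]) simp
  ultimately show ?thesis by simp
qed

section \<open>Contraction and the Koszul kernel\<close>

lemma case_nat_upd_0: "(case_nat v x)(0 := w) = case_nat w x"
  by (auto split: nat.split)

lemma case_nat_upd_Suc: "(case_nat v x)(Suc i := w) = case_nat v (x(i := w))"
  by (auto split: nat.split)

lemma case_nat_comp: "g \<circ> case_nat v x = case_nat (g v) (g \<circ> x)"
  by (auto split: nat.split)

lemma koszul_first_apply: "koszul_first p \<xi> v x = \<xi> (case_nat v x)"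
  by (simp add: koszul_first_def koszul_def)

lemma alt_forms_case_nat:
  assumes \<xi>: "\<xi> \<in> alt_forms scale UNIV (Suc p)"
  shows "(\<lambda>x. \<xi> (case_nat v x)) \<in> alt_forms scale UNIV p"
proof (rule alt_formsI)
  show "\<xi> (case_nat v x) = \<xi> (case_nat v y)" if "\<And>i. i < p \<Longrightarrow> x i = y i" for x y
    using that by (intro alt_forms_cong[OF \<xi>]) (auto split: nat.split)
  show "\<xi> (case_nat v (x(i := a *s u + w))) = a * \<xi> (case_nat v (x(i := u))) + \<xi> (case_nat v (x(i := w)))"
    if "i < p" for x i u w a
    using alt_forms_lincomb[OF \<xi>, of "Suc i" u w "case_nat v x" a] that by (simp add: case_nat_upd_Suc)
  show "\<xi> (case_nat v x) = 0" if "i < j" "j < p" "x i = x j" for x i j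
    using that by (intro alt_forms_alternating[OF \<xi>, of "Suc i" "Suc j"]) auto
qed auto

lemma alt_forms_head_dual:
  assumes \<xi>: "\<xi> \<in> alt_forms scale UNIV (Suc p)"
  shows "(\<lambda>v. \<xi> (case_nat v x)) \<in> dual_space scale"
  using alt_forms_add[OF \<xi>, of 0 "case_nat 0 x"] alt_forms_scale[OF \<xi>, of 0 "case_nat 0 x"]
  by (auto simp: dual_space_iff case_nat_upd_0)

text \<open>Homogeneous polynomials of degree 1 are linear forms, and zero contraction is
  alternation between \<open>v\<close> and the other arguments. For \<open>p = 0\<close> the
  vanishing condition is empty, in accordance with \<open>koszul 0\<close> being zero.\<close>

lemma koszul_kernel_iff:
  "\<eta> \<in> koszul_kernel scale p \<longleftrightarrow> (\<forall>v. \<eta> v \<in> alt_forms scale UNIV p) \<and>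
    (\<forall>x. (\<lambda>v. \<eta> v x) \<in> dual_space scale) \<and> (\<forall>v x k. k < p \<and> x k = v \<longrightarrow> \<eta> v x = 0)"
    (is "?L \<longleftrightarrow> ?R")
proof
  assume L: ?L
  then have alt: "\<eta> v \<in> alt_forms scale UNIV p" for v by (simp add: koszul_kernel_def alt_sym_def)
  have "(\<lambda>v. \<eta> v x) \<in> dual_space scale" for x
    using L by (intro homogeneous_poly_fun_dual) (auto simp: koszul_kernel_def alt_sym_def)
  moreover have "\<eta> v x = 0" if "k < p" "x k = v" for v x k
  proof (rule alt_forms_vanish_at[where v = v and k = k, OF alt])
    fix y :: "nat \<Rightarrow> 'v" assume "0 < p" "y 0 = v"
    have "koszul p \<eta> v (\<lambda>i. y (Suc i)) = 0" using L by (simp add: koszul_kernel_def)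
    moreover have "case_nat v (\<lambda>i. y (Suc i)) = y" using \<open>y 0 = v\<close> by (auto split: nat.split)
    ultimately show "\<eta> v y = 0" using \<open>0 < p\<close> by (simp add: koszul_def)
  qed (use that in auto)
  ultimately show ?R using alt by blast
next
  assume R: ?R
  then have "poly_fun scale (\<lambda>v. \<eta> v x)" "\<eta> (c *s v) x = c * \<eta> v x" for c v x
    by (auto simp: dual_space_iff intro!: poly_fun_dual)
  moreover have "\<eta> v (case_nat v x) = 0" if "0 < p" for v x
    using R that by (metis old.nat.simps(4))
  then have "koszul p \<eta> = 0" by (auto simp: koszul_def fun_eq_iff)
  ultimately show ?L using R by (simp add: koszul_kernel_def alt_sym_def)
qed

lemma koszul_first_in_kernel:
  assumes \<xi>: "\<xi> \<in> alt_forms scale UNIV (Suc p)"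
  shows "koszul_first p \<xi> \<in> koszul_kernel scale p"
  unfolding koszul_kernel_iff
proof (intro conjI allI impI)
  show "koszul_first p \<xi> v \<in> alt_forms scale UNIV p" for v
    using alt_forms_case_nat[OF \<xi>] by (simp add: koszul_first_apply[abs_def])
  show "(\<lambda>v. koszul_first p \<xi> v x) \<in> dual_space scale" for x
    using alt_forms_head_dual[OF \<xi>] by (simp add: koszul_first_apply)
  show "koszul_first p \<xi> v x = 0" if "k < p \<and> x k = v" for v x k
    unfolding koszul_first_apply using that
    by (intro alt_forms_alternating[OF \<xi>, of 0 "Suc k"]) auto
qed

text \<open>The Koszul differential is inverted by uncurrying: \<open>v\<close> becomes slot 0. As
  \<open>koszul_first\<close> inserts an argument without antisymmetrizing, no division by
  \<open>p + 1\<close> occurs.\<close>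

lemma koszul_first_preimage:
  assumes \<eta>: "\<eta> \<in> koszul_kernel scale p"
  shows "(\<lambda>x. \<eta> (x 0) (\<lambda>i. x (Suc i))) \<in> alt_forms scale UNIV (Suc p)"
proof (rule alt_formsI)
  from \<eta> have alt: "\<eta> v \<in> alt_forms scale UNIV p" for v by (simp add: koszul_kernel_iff)
  from \<eta> have dual: "(\<lambda>v. \<eta> v x) \<in> dual_space scale" for x by (simp add: koszul_kernel_iff)
  from \<eta> have van: "\<eta> v x = 0" if "k < p" "x k = v" for v x k
    using that koszul_kernel_iff[THEN iffD1, OF \<eta>] by blast
  show "\<eta> (x 0) (\<lambda>i. x (Suc i)) = \<eta> (y 0) (\<lambda>i. y (Suc i))"
    if "\<And>i. i < Suc p \<Longrightarrow> x i = y i" for x y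
    using that alt_forms_cong[OF alt, of "\<lambda>i. x (Suc i)" "\<lambda>i. y (Suc i)"] by auto
  show "\<eta> ((x(i := a *s u + w)) 0) (\<lambda>j. (x(i := a *s u + w)) (Suc j)) =
      a * \<eta> ((x(i := u)) 0) (\<lambda>j. (x(i := u)) (Suc j)) + \<eta> ((x(i := w)) 0) (\<lambda>j. (x(i := w)) (Suc j))"
    if "i < Suc p" for x i u w a
  proof (cases i)
    case 0
    then show ?thesis using dual_add[OF dual] dual_scale[OF dual] by simp
  next
    case (Suc k)
    have "(\<lambda>j. (x(i := z)) (Suc j)) = (\<lambda>j. x (Suc j))(k := z)" for z by (auto simp: Suc)
    then show ?thesis using alt_forms_lincomb[OF alt, of k] that Suc by simp
  qed
  show "\<eta> (x 0) (\<lambda>i. x (Suc i)) = 0" if "i < j" "j < Suc p" "x i = x j" for x i j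
  proof -
    obtain m where m: "j = Suc m" using \<open>i < j\<close> by (cases j) auto
    \<comment> \<open>A repetition involving slot 0 is handled by the kernel condition, any other by
      alternation of \<open>\<eta> v\<close>.\<close>
    show ?thesis
    proof (cases i)
      case 0
      then show ?thesis using that m by (intro van[of m]) auto
    next
      case (Suc k)
      then show ?thesis using that m by (intro alt_forms_alternating[OF alt, of k m]) auto
    qed
  qed
qed auto

lemma koszul_first_bij:
  "bij_betw (koszul_first p) (alt_forms scale UNIV (Suc p)) (koszul_kernel scale p)"
proof (rule bij_betwI[where g = "\<lambda>\<eta> x. \<eta> (x 0) (\<lambda>i. x (Suc i))"])
  have *: "case_nat (x 0) (\<lambda>i. x (Suc i)) = x" for x :: "nat \<Rightarrow> 'v" by (auto split: nat.split)
  show "(\<lambda>x. koszul_first p \<xi> (x 0) (\<lambda>i. x (Suc i))) = \<xi>" for \<xi> :: "(nat \<Rightarrow> 'v) \<Rightarrow> 'k"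
    by (simp add: koszul_first_apply *)
  show "koszul_first p (\<lambda>x. \<eta> (x 0) (\<lambda>i. x (Suc i))) = \<eta>" for \<eta> :: "'v \<Rightarrow> (nat \<Rightarrow> 'v) \<Rightarrow> 'k"
    by (simp add: fun_eq_iff koszul_first_apply)
qed (use koszul_first_in_kernel koszul_first_preimage in auto)

subsection \<open>Global sections on projective space\<close>

lemma
  assumes "s \<in> proj_forms scale p m"
  shows proj_forms_eq_0: "l \<notin> dual_space scale \<or> l v \<noteq> 1 \<Longrightarrow> s l v = 0"
    and proj_forms_alt: "l \<in> dual_space scale \<Longrightarrow> l v = 1 \<Longrightarrow> s l v \<in> alt_forms scale {w. l w = 0} p"
    and proj_forms_regular: "l \<in> dual_space scale \<Longrightarrow> (\<And>i. i < p \<Longrightarrow> l (x i) = 0) \<Longrightarrow>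
      \<exists>P. poly_fun scale P \<and> (\<forall>v. l v = 1 \<longrightarrow> s l v x = P v)"
    and proj_forms_glue: "l \<in> dual_space scale \<Longrightarrow> l' \<in> dual_space scale \<Longrightarrow> l v = 1 \<Longrightarrow> l' v \<noteq> 0 \<Longrightarrow>
      (\<And>i. i < p \<Longrightarrow> l (x i) = 0) \<Longrightarrow>
      s l v x = l' v ^ m * s l' (chart_proj scale l' v) (chart_deriv scale l' v \<circ> x)"
proof -
  note s = assms[unfolded proj_forms_def mem_Collect_eq]
  show "l \<notin> dual_space scale \<or> l v \<noteq> 1 \<Longrightarrow> s l v = 0"
    using s[THEN conjunct1] s[THEN conjunct2, THEN conjunct1] by (cases "l \<in> dual_space scale") auto
  show "l \<in> dual_space scale \<Longrightarrow> l v = 1 \<Longrightarrow> s l v \<in> alt_forms scale {w. l w = 0} p"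
    using s[THEN conjunct2, THEN conjunct1] by simp
  show "l \<in> dual_space scale \<Longrightarrow> (\<And>i. i < p \<Longrightarrow> l (x i) = 0) \<Longrightarrow>
      \<exists>P. poly_fun scale P \<and> (\<forall>v. l v = 1 \<longrightarrow> s l v x = P v)"
    using s[THEN conjunct2, THEN conjunct1] by simp
  show "l \<in> dual_space scale \<Longrightarrow> l' \<in> dual_space scale \<Longrightarrow> l v = 1 \<Longrightarrow> l' v \<noteq> 0 \<Longrightarrow>
      (\<And>i. i < p \<Longrightarrow> l (x i) = 0) \<Longrightarrow>
      s l v x = l' v ^ m * s l' (chart_proj scale l' v) (chart_deriv scale l' v \<circ> x)"
    using s[THEN conjunct2, THEN conjunct2] by blast
qed

lemma chart_proj_id: "l v = 1 \<Longrightarrow> chart_proj scale l v = v"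
  by (simp add: chart_proj_def)

lemma chart_deriv_one: "l v = 1 \<Longrightarrow> chart_deriv scale l v w = w - l w *s v"
  by (simp add: chart_deriv_def)

lemma dual_chart_deriv:
  "l \<in> dual_space scale \<Longrightarrow> l v \<noteq> 0 \<Longrightarrow> l (chart_deriv scale l v w) = 0"
  by (simp add: chart_deriv_def dual_diff dual_scale field_simps power2_eq_square)

lemma chart_deriv_linear:
  assumes "l \<in> dual_space scale" shows "Vector_Spaces.linear scale scale (chart_deriv scale l v)"
  using vector_space_axioms
  by (simp add: Vector_Spaces.linear_iff chart_deriv_def dual_add[OF assms] dual_scale[OF assms]
      algebra_simps add_divide_distrib)

text \<open>Removes the arbitrary choice of chart. Where \<open>l v = 1\<close> and
  \<open>l0 v = 1\<close>, the gluing factor is 1 and the point is fixed; projecting along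
  \<open>v\<close> to the kernel of \<open>l0\<close> and then to that of \<open>l\<close> amounts
  to projecting to the latter at once.\<close>

lemma cone_value_eq:
  assumes s: "s \<in> proj_forms scale p m" and l: "l \<in> dual_space scale" "l v = 1"
  shows "cone_value scale s v x = s l v (chart_deriv scale l v \<circ> x)"
proof -
  define l0 where "l0 = (SOME l. l \<in> dual_space scale \<and> l v = 1)"
  have "\<exists>l. l \<in> dual_space scale \<and> l v = 1" using l by blast
  from someI_ex[OF this] have l0: "l0 \<in> dual_space scale" "l0 v = 1" by (simp_all add: l0_def)
  have "cone_value scale s v x = s l0 v (chart_deriv scale l0 v \<circ> x)"
    by (simp add: cone_value_def Let_def flip: l0_def)
  also have "\<dots> = l v ^ m * s l (chart_proj scale l v) (chart_deriv scale l v \<circ> (chart_deriv scale l0 v \<circ> x))"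
    using l l0 by (intro proj_forms_glue[OF s]) (auto simp: dual_chart_deriv)
  also have "\<dots> = s l v (chart_deriv scale l v \<circ> (chart_deriv scale l0 v \<circ> x))"
    using l by (simp add: chart_proj_id)
  also have "chart_deriv scale l v \<circ> (chart_deriv scale l0 v \<circ> x) = chart_deriv scale l v \<circ> x"
    using l l0 by (auto simp: chart_deriv_one dual_diff dual_scale algebra_simps)
  finally show ?thesis .
qed

lemma section_eq_cone_value:
  assumes s: "s \<in> proj_forms scale p m" and l: "l \<in> dual_space scale" "l v = 1"
    and x: "\<And>i. i < p \<Longrightarrow> l (x i) = 0"
  shows "s l v x = cone_value scale s v x"
  unfolding cone_value_eq[OF s l]
  by (rule alt_forms_cong[OF proj_forms_alt[OF s l]]) (simp add: chart_deriv_one l x)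

lemma cone_value_alt:
  assumes s: "s \<in> proj_forms scale p m" and "v \<noteq> 0"
  shows "cone_value scale s v \<in> alt_forms scale UNIV p"
proof -
  obtain l where l: "l \<in> dual_space scale" "l v = 1" using dual_nonzero \<open>v \<noteq> 0\<close> by blast
  have "(\<lambda>x. s l v (chart_deriv scale l v \<circ> x)) \<in> alt_forms scale UNIV p"
    using l by (intro alt_forms_pullback[OF proj_forms_alt[OF s l] chart_deriv_linear])
      (auto simp: dual_chart_deriv)
  then show ?thesis by (simp add: cone_value_eq[OF s l, abs_def])
qed

lemma cone_value_radial:
  assumes s: "s \<in> proj_forms scale p m" and "v \<noteq> 0" and k: "k < p" "x k = v"
  shows "cone_value scale s v x = 0"
proof -
  obtain l where l: "l \<in> dual_space scale" "l v = 1" using dual_nonzero \<open>v \<noteq> 0\<close> by blast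
  show ?thesis unfolding cone_value_eq[OF s l]
    using k l by (intro alt_forms_zero[OF proj_forms_alt[OF s l] k(1)]) (simp add: chart_deriv_one)
qed

text \<open>The chart \<open>l\<close> at \<open>v\<close> is compared with its multiple by
  \<open>inverse c\<close> at \<open>c *s v\<close>. Gluing contributes
  \<open>inverse c ^ (p + 1)\<close> and the rescaled arguments contribute \<open>c ^ p\<close>, so
  the twist leaves exactly degree 1.\<close>

lemma cone_value_homogeneous:
  assumes s: "s \<in> proj_forms scale p (p + 1)" and v: "v \<noteq> 0" and c: "c \<noteq> 0"
  shows "cone_value scale s (c *s v) x = c * cone_value scale s v x"
proof -
  obtain l where l: "l \<in> dual_space scale" "l v = 1" using dual_nonzero v by blast
  define l' where "l' = (\<lambda>w. inverse c * l w)"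
  have l': "l' \<in> dual_space scale" "l' (c *s v) = 1" "l' v = inverse c"
    using l c by (auto simp: l'_def dual_space_iff algebra_simps)
  have cv: "c *s v \<noteq> 0" using v c by simp
  have proj: "chart_proj scale l' v = c *s v" by (simp add: chart_proj_def l')
  have "cone_value scale s v x = s l v (chart_deriv scale l v \<circ> x)" by (rule cone_value_eq[OF s l])
  also have "\<dots> = l' v ^ (p + 1) * s l' (c *s v) (chart_deriv scale l' v \<circ> (chart_deriv scale l v \<circ> x))"
    using l l' c by (subst proj_forms_glue[OF s l(1) l'(1)]) (auto simp: dual_chart_deriv proj)
  \<comment> \<open>The summand \<open>0 *s (c *s v)\<close> only brings the arguments into the
    shape of \<open>alt_forms_affine\<close>.\<close>
  also have "chart_deriv scale l' v \<circ> (chart_deriv scale l v \<circ> x)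
      = chart_deriv scale l' (c *s v) \<circ> (\<lambda>i. c *s x i + 0 *s (c *s v))"
  proof
    fix i
    have "l' (chart_deriv scale l v (x i)) = 0" using l by (simp add: l'_def dual_chart_deriv)
    then have "chart_deriv scale l' v (chart_deriv scale l v (x i)) = c *s (x i - l (x i) *s v)"
      using l by (simp add: chart_deriv_def[of scale l'] l'(3) chart_deriv_one)
    moreover have "l' (c *s x i) = l (x i)" using l c by (simp add: l'_def dual_scale)
    ultimately show "(chart_deriv scale l' v \<circ> (chart_deriv scale l v \<circ> x)) i
        = (chart_deriv scale l' (c *s v) \<circ> (\<lambda>i. c *s x i + 0 *s (c *s v))) i"
      using l' by (simp add: chart_deriv_one algebra_simps)
  qed
  also have "s l' (c *s v) \<dots> = cone_value scale s (c *s v) (\<lambda>i. c *s x i + 0 *s (c *s v))"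
    by (rule cone_value_eq[OF s l'(1,2), symmetric])
  also have "\<dots> = c ^ p * cone_value scale s (c *s v) x"
    by (rule alt_forms_affine[OF cone_value_alt[OF s cv]]) (rule cone_value_radial[OF s cv])
  finally show ?thesis using c l'(3) by (simp add: field_simps)
qed

lemma euler_map_in_kernel:
  assumes s: "s \<in> proj_forms scale p (p + 1)"
  shows "euler_map scale s \<in> koszul_kernel scale p"
  unfolding koszul_kernel_iff
proof (intro conjI allI impI)
  show "euler_map scale s v \<in> alt_forms scale UNIV p" for v
    using cone_value_alt[OF s, of v] zero_in_alt_forms
    by (cases "v = 0") (auto simp: euler_map_def zero_fun_def)
  show "euler_map scale s v x = 0" if "k < p \<and> x k = v" for v x k
    using that cone_value_radial[OF s] by (auto simp: euler_map_def)
  show "(\<lambda>v. euler_map scale s v x) \<in> dual_space scale" for x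
  proof (rule homogeneous_polynomial_on_lines_dual)
    show "euler_map scale s (c *s v) x = c * euler_map scale s v x" for c v
      using cone_value_homogeneous[OF s] by (cases "c = 0") (auto simp: euler_map_def)
    fix u w assume "u \<notin> span {w}"
    then obtain l where l: "l \<in> dual_space scale" "l u = 1" "l w = 0" using dual_separates by blast
    have l1: "l (u + t *s w) = 1" for t using l by (simp add: dual_add dual_scale)
    \<comment> \<open>The arguments are \<open>x i - l (x i) *s (u + t *s w)\<close>, the
      projections along the moving point onto the kernel of \<open>l\<close>. They are affine in
      \<open>t\<close>, and the kernel stays the same because the line does not leave the
      chart.\<close>
    have "polynomial_map (\<lambda>t. s l (u + t *s w) (\<lambda>i. (x i - l (x i) *s u) + t *s ((- l (x i)) *s w)))"
    proof (rule alt_forms_polynomial)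
      show "subspace {w. l w = 0}" using l by (simp add: subspace_def dual_add dual_scale dual_zero)
      show "s l (u + t *s w) \<in> alt_forms scale {w. l w = 0} p" for t
        by (rule proj_forms_alt[OF s l(1) l1])
      show "polynomial_map (\<lambda>t. s l (u + t *s w) y)" if y: "\<And>i. i < p \<Longrightarrow> y i \<in> {w. l w = 0}" for y
      proof -
        obtain P where P: "poly_fun scale P" "\<forall>v. l v = 1 \<longrightarrow> s l v y = P v"
          using proj_forms_regular[OF s l(1), of y] y by auto
        then show ?thesis using poly_fun_line[OF P(1), of u w] l1 by simp
      qed
    qed (use l in \<open>auto simp: dual_diff dual_scale dual_minus\<close>)
    moreover have "euler_map scale s (u + t *s w) x
        = s l (u + t *s w) (\<lambda>i. (x i - l (x i) *s u) + t *s ((- l (x i)) *s w))" for t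
    proof -
      have "u + t *s w \<noteq> 0" using l1[of t] dual_zero[OF l(1)] by auto
      moreover have "chart_deriv scale l (u + t *s w) \<circ> x
          = (\<lambda>i. (x i - l (x i) *s u) + t *s ((- l (x i)) *s w))"
        using l1 by (auto simp: chart_deriv_one algebra_simps)
      ultimately show ?thesis using cone_value_eq[OF s l(1) l1] by (simp add: euler_map_def)
    qed
    ultimately show "polynomial_map (\<lambda>t. euler_map scale s (u + t *s w) x)" by simp
  qed
qed

lemma euler_map_inj: "inj_on (euler_map scale) (proj_forms scale p m)"
proof (rule inj_onI, intro ext)
  fix s t l v x
  assume s: "s \<in> proj_forms scale p m" and t: "t \<in> proj_forms scale p m"
    and eq: "euler_map scale s = euler_map scale t"
  show "s l v x = t l v x"
  proof (cases "l \<in> dual_space scale \<and> l v = 1")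
    case True
    then have l: "l \<in> dual_space scale" "l v = 1" by auto
    show ?thesis
    proof (cases "\<forall>i<p. l (x i) = 0")
      case True
      have "v \<noteq> 0" using l dual_zero[OF l(1)] by auto
      then have "cone_value scale s v x = cone_value scale t v x"
        using fun_cong[OF fun_cong[OF eq, of v], of x] by (simp add: euler_map_def)
      then show ?thesis using True by (simp add: section_eq_cone_value[OF s l] section_eq_cone_value[OF t l])
    next
      case False
      then show ?thesis
        using alt_forms_outside[OF proj_forms_alt[OF s l]] alt_forms_outside[OF proj_forms_alt[OF t l]]
        by fastforce
    qed
  qed (use proj_forms_eq_0[OF s] proj_forms_eq_0[OF t] in auto)
qed

section \<open>The section of a form: contraction with the Euler field, restricted to each
  chart\<close>

definition form_section :: "nat \<Rightarrow> ((nat \<Rightarrow> 'v) \<Rightarrow> 'k) \<Rightarrow> ('v \<Rightarrow> 'k) \<Rightarrow> 'v \<Rightarrow> (nat \<Rightarrow> 'v) \<Rightarrow> 'k" where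
  "form_section p \<xi> l v x =
     (if l \<in> dual_space scale \<and> l v = 1 \<and> (\<forall>i<p. l (x i) = 0) then \<xi> (case_nat v x) else 0)"

text \<open>In the gluing condition, moving the base point costs one factor
  \<open>inverse (l' v)\<close> and the arguments cost \<open>p\<close> more, the multiples of
  \<open>v\<close> in \<open>chart_deriv\<close> being killed by contraction. This cancels
  \<open>l' v ^ (p + 1)\<close>.\<close>

lemma form_section_in_proj_forms:
  assumes \<xi>: "\<xi> \<in> alt_forms scale UNIV (Suc p)"
  shows "form_section p \<xi> \<in> proj_forms scale p (p + 1)"
  unfolding proj_forms_def
proof (intro CollectI conjI allI ballI impI)
  have ker: "koszul_first p \<xi> \<in> koszul_kernel scale p" by (rule koszul_first_in_kernel[OF \<xi>])
  fix l assume l: "l \<in> dual_space scale"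
  show "form_section p \<xi> l v \<in> alt_forms scale {w. l w = 0} p" if "l v = 1" for v
  proof -
    have "subspace {w. l w = 0}" using l by (simp add: subspace_def dual_add dual_scale dual_zero)
    then have "(\<lambda>x. if \<forall>i<p. x i \<in> {w. l w = 0} then \<xi> (case_nat v x) else 0)
        \<in> alt_forms scale {w. l w = 0} p"
      by (rule alt_forms_restrict[OF alt_forms_case_nat[OF \<xi>]])
    moreover have "form_section p \<xi> l v = (\<lambda>x. if \<forall>i<p. x i \<in> {w. l w = 0} then \<xi> (case_nat v x) else 0)"
      using l that by (auto simp: form_section_def)
    ultimately show ?thesis by simp
  qed
  show "\<exists>P. poly_fun scale P \<and> (\<forall>v. l v = 1 \<longrightarrow> form_section p \<xi> l v x = P v)"
    if "\<forall>i<p. l (x i) = 0" for x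
    using l that alt_forms_head_dual[OF \<xi>, of x]
    by (intro exI[of _ "\<lambda>v. \<xi> (case_nat v x)"]) (auto simp: form_section_def intro: poly_fun_dual)
  fix l' v x
  assume l': "l' \<in> dual_space scale" and A: "l v = 1 \<and> l' v \<noteq> 0 \<and> (\<forall>i<p. l (x i) = 0)"
  have "form_section p \<xi> l' (chart_proj scale l' v) (chart_deriv scale l' v \<circ> x)
      = \<xi> (case_nat (chart_proj scale l' v) (chart_deriv scale l' v \<circ> x))"
    using l' A by (auto simp: form_section_def dual_chart_deriv) (auto simp: chart_proj_def dual_scale)
  also have "\<dots> = inverse (l' v) * koszul_first p \<xi> v (chart_deriv scale l' v \<circ> x)"
    unfolding chart_proj_def koszul_first_apply by (rule dual_scale[OF alt_forms_head_dual[OF \<xi>]])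
  also have "koszul_first p \<xi> v (chart_deriv scale l' v \<circ> x)
      = koszul_first p \<xi> v (\<lambda>i. inverse (l' v) *s x i + (- (l' (x i) / (l' v)\<^sup>2)) *s v)"
    by (simp add: chart_deriv_def comp_def)
  also have "\<dots> = inverse (l' v) ^ p * koszul_first p \<xi> v x"
    using ker unfolding koszul_kernel_iff by (intro alt_forms_affine) blast+
  finally have "form_section p \<xi> l' (chart_proj scale l' v) (chart_deriv scale l' v \<circ> x)
      = inverse (l' v) * (inverse (l' v) ^ p * koszul_first p \<xi> v x)" .
  moreover have "form_section p \<xi> l v x = koszul_first p \<xi> v x"
    using l A by (simp add: form_section_def koszul_first_apply)
  ultimately show "form_section p \<xi> l v x = l' v ^ (p + 1) *
      form_section p \<xi> l' (chart_proj scale l' v) (chart_deriv scale l' v \<circ> x)"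
    using A by (simp add: field_simps)
qed (auto simp: form_section_def fun_eq_iff)

lemma cone_value_form_section:
  assumes \<xi>: "\<xi> \<in> alt_forms scale UNIV (Suc p)" and "v \<noteq> 0"
  shows "cone_value scale (form_section p \<xi>) v x = \<xi> (case_nat v x)"
proof -
  obtain l where l: "l \<in> dual_space scale" "l v = 1" using dual_nonzero \<open>v \<noteq> 0\<close> by blast
  have ker: "koszul_first p \<xi> \<in> koszul_kernel scale p" by (rule koszul_first_in_kernel[OF \<xi>])
  have "cone_value scale (form_section p \<xi>) v x = koszul_first p \<xi> v (chart_deriv scale l v \<circ> x)"
    using l by (simp add: cone_value_eq[OF form_section_in_proj_forms[OF \<xi>] l] form_section_def
        koszul_first_apply dual_chart_deriv)
  also have "chart_deriv scale l v \<circ> x = (\<lambda>i. 1 *s x i + (- l (x i)) *s v)"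
    using l by (auto simp: chart_deriv_one)
  also have "koszul_first p \<xi> v \<dots> = 1 ^ p * koszul_first p \<xi> v x"
    using ker unfolding koszul_kernel_iff by (intro alt_forms_affine) blast+
  finally show ?thesis by (simp add: koszul_first_apply)
qed

lemma euler_map_form_section:
  assumes \<xi>: "\<xi> \<in> alt_forms scale UNIV (Suc p)"
  shows "euler_map scale (form_section p \<xi>) = koszul_first p \<xi>"
  using cone_value_form_section[OF \<xi>] dual_zero[OF alt_forms_head_dual[OF \<xi>]]
  by (auto simp: fun_eq_iff euler_map_def koszul_first_apply)

lemma euler_map_bij: "bij_betw (euler_map scale) (proj_forms scale p (p + 1)) (koszul_kernel scale p)"
  unfolding bij_betw_def
proof (intro conjI euler_map_inj equalityI subsetI)
  fix \<eta> assume "\<eta> \<in> koszul_kernel scale p"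
  then obtain \<xi> where \<xi>: "\<xi> \<in> alt_forms scale UNIV (Suc p)" and "\<eta> = koszul_first p \<xi>"
    using koszul_first_bij[of p] by (auto simp: bij_betw_def)
  then have "\<eta> = euler_map scale (form_section p \<xi>)" by (simp add: euler_map_form_section)
  then show "\<eta> \<in> euler_map scale ` proj_forms scale p (p + 1)"
    using form_section_in_proj_forms[OF \<xi>] by blast
qed (use euler_map_in_kernel in auto)

text \<open>Injectivity of \<open>euler_map\<close> turns the inverse into an explicit formula, so
  that linearity and equivariance become computations with \<open>\<xi>\<close>.\<close>

lemma koszul_description_eq:
  assumes \<xi>: "\<xi> \<in> alt_forms scale UNIV (Suc p)"
  shows "koszul_description scale p \<xi> = form_section p \<xi>"
  unfolding koszul_description_def
  by (intro inv_into_f_eq euler_map_inj form_section_in_proj_forms \<xi> euler_map_form_section)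

lemma koszul_description_bij:
  "bij_betw (koszul_description scale p) (alt_forms scale UNIV (Suc p)) (proj_forms scale p (p + 1))"
  using bij_betw_trans[OF koszul_first_bij bij_betw_inv_into[OF euler_map_bij]]
  by (simp add: koszul_description_def[abs_def] comp_def)

lemma section_action_form_section:
  assumes g: "g \<in> GL scale"
  shows "section_action g (form_section p \<xi>) = form_section p (form_action g \<xi>)"
  by (auto simp: fun_eq_iff section_action_def form_section_def form_action_def dual_comp_GL[OF g]
      GL_inv_right[OF g] case_nat_comp)

lemma section_action_comp:
  assumes "g \<in> GL scale" "h \<in> GL scale"
  shows "section_action g (section_action h s) = section_action (g \<circ> h) s"
  using GL_inv_comp[OF assms] by (simp add: section_action_def comp_assoc)

subsection \<open>Equivariant maps on the general linear group\<close>

lemma psi_apply: "psi scale v0 \<xi> g u x =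
    (if u \<in> line scale v0 \<and> g \<in> GL scale then \<xi> (case_nat (g u) (g \<circ> x)) else 0)"
  by (simp add: psi_def ext_product_dual_def coaction_def case_nat_comp)

lemma alt_forms_sum:
  assumes \<xi>: "\<xi> \<in> alt_forms scale UNIV q" "i < q" and "finite S"
  shows "\<xi> (x(i := (\<Sum>b\<in>S. c b *s b))) = (\<Sum>b\<in>S. c b * \<xi> (x(i := b)))"
  using \<open>finite S\<close>
proof induction
  case empty
  then show ?case by (simp add: alt_forms_zero[OF \<xi>])
next
  case (insert b S)
  show ?case
    by (simp only: sum.insert[OF insert.hyps] alt_forms_lincomb[OF \<xi> UNIV_I UNIV_I] insert.IH)
qed

lemma GL_regular_sum:
  "finite S \<Longrightarrow> (\<And>b. b \<in> S \<Longrightarrow> GL_regular scale (F b)) \<Longrightarrow> GL_regular scale (\<lambda>g. \<Sum>b\<in>S. F b g)"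
  by (induction rule: finite_induct) (auto intro: GL_regular.intros)

text \<open>One slot at a time, \<open>g (y n)\<close> is expanded in the basis. Its coordinates are
  matrix coefficients, and a constant is left when no slot involves \<open>g\<close> any
  more.\<close>

lemma GL_regular_alt_form:
  assumes \<xi>: "\<xi> \<in> alt_forms scale UNIV q"
  shows "GL_regular scale (\<lambda>g. \<xi> (g \<circ> y))"
proof -
  have "GL_regular scale (\<lambda>g. \<xi> (\<lambda>i. if i < n then g (y i) else y i))" if "n \<le> q" for n y
    using that
  proof (induction n arbitrary: y)
    case (Suc n)
    have n: "n < q" using Suc.prems by simp
    let ?x = "\<lambda>y g i. if i < n then g (y i) else y i"
    let ?c = "\<lambda>v b. representation Basis v b"
    have "\<xi> (\<lambda>i. if i < Suc n then g (y i) else y i) = (\<Sum>b\<in>Basis. ?c (g (y n)) b * \<xi> (?x (y(n := b)) g))"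
      for g :: "'v \<Rightarrow> 'v"
    proof -
      have "\<xi> (\<lambda>i. if i < Suc n then g (y i) else y i) = \<xi> ((?x y g)(n := (\<Sum>b\<in>Basis. ?c (g (y n)) b *s b)))"
        by (subst sum_representation_eq[OF independent_Basis])
          (auto simp: span_Basis finite_Basis less_Suc_eq intro!: arg_cong[of _ _ \<xi>])
      also have "\<dots> = (\<Sum>b\<in>Basis. ?c (g (y n)) b * \<xi> ((?x y g)(n := b)))"
        by (rule alt_forms_sum[OF \<xi> n finite_Basis])
      also have "\<dots> = (\<Sum>b\<in>Basis. ?c (g (y n)) b * \<xi> (?x (y(n := b)) g))"
        by (intro sum.cong refl arg_cong2[of _ _ _ _ "(*)"] arg_cong[of _ _ \<xi>]) auto
      finally show ?thesis .
    qed
    moreover have "(\<lambda>v. ?c v b) \<in> dual_space scale" for b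
      using linear_representation[OF independent_Basis span_Basis] by (simp add: dual_space_def)
    then have "GL_regular scale (\<lambda>g. \<Sum>b\<in>Basis. ?c (g (y n)) b * \<xi> (?x (y(n := b)) g))"
      using Suc by (intro GL_regular_sum finite_Basis GL_regular_mult GL_regular_coeff Suc.IH) auto
    ultimately show ?case by simp
  qed (simp add: GL_regular_const)
  from this[OF order.refl] have "GL_regular scale (\<lambda>g. \<xi> (\<lambda>i. if i < q then g (y i) else y i))" .
  moreover have "\<xi> (\<lambda>i. if i < q then g (y i) else y i) = \<xi> (g \<circ> y)" for g :: "'v \<Rightarrow> 'v"
    by (rule alt_forms_cong[OF \<xi>]) simp
  ultimately show ?thesis by simp
qed

lemma psi_in_bal_tensor:
  assumes \<xi>: "\<xi> \<in> alt_forms scale UNIV (Suc p)"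
  shows "psi scale v0 \<xi> \<in> bal_tensor scale v0 p"
  unfolding bal_tensor_def
proof (intro CollectI conjI allI impI ballI)
  note ker = koszul_first_in_kernel[OF \<xi>, unfolded koszul_kernel_iff koszul_first_apply]
  note dual = alt_forms_head_dual[OF \<xi>]
  fix g assume g: "g \<in> GL scale"
  show "psi scale v0 \<xi> g \<in> fibre scale v0 p"
    unfolding fibre_def
  proof (intro CollectI conjI allI impI ballI)
    fix u assume u: "u \<in> line scale v0"
    have "(\<lambda>x. \<xi> (case_nat (g u) (g \<circ> x))) \<in> alt_forms scale UNIV p"
      by (rule alt_forms_pullback[OF alt_forms_case_nat[OF \<xi>] GL_linear[OF g]]) simp
    moreover have "psi scale v0 \<xi> g u = (\<lambda>x. \<xi> (case_nat (g u) (g \<circ> x)))"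
      using g u by (simp add: fun_eq_iff psi_apply)
    ultimately show "psi scale v0 \<xi> g u \<in> alt_forms scale UNIV p" by simp
    show "psi scale v0 \<xi> g u x = 0" if x: "\<exists>i<p. x i \<in> line scale v0" for x
    proof -
      obtain i a b where i: "i < p" and "u = a *s v0" "x i = b *s v0" using u x by (auto simp: line_iff)
      then have eq: "g u = a *s g v0" "(g \<circ> x)(i := b *s g v0) = g \<circ> x" by (auto simp: GL_scale[OF g])
      \<comment> \<open>Both \<open>u\<close> and \<open>x i\<close> are multiples of
        \<open>v0\<close>, possibly zero; extracting the scalars leaves \<open>g v0\<close> in two
        slots.\<close>
      have "\<xi> (case_nat (g v0) (g \<circ> x)) = b * \<xi> (case_nat (g v0) ((g \<circ> x)(i := g v0)))"
        using alt_forms_scale[OF alt_forms_case_nat[OF \<xi>] i, of "g v0" "g \<circ> x" b "g v0"] eq(2) by simp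
      also have "\<xi> (case_nat (g v0) ((g \<circ> x)(i := g v0))) = 0"
        using i by (intro alt_forms_alternating[OF \<xi>, of 0 "Suc i"]) auto
      finally show ?thesis using dual_scale[OF dual] by (simp add: psi_apply eq(1))
    qed
    show "psi scale v0 \<xi> g (a *s u + w) x = a * psi scale v0 \<xi> g u x + psi scale v0 \<xi> g w x"
      if w: "w \<in> line scale v0" for w a x
    proof -
      have "a *s u + w \<in> line scale v0" using u w by (simp add: line_def span_add span_scale)
      then show ?thesis using u w g
        by (simp add: psi_apply GL_add[OF g] GL_scale[OF g] dual_add[OF dual] dual_scale[OF dual])
    qed
  qed (simp add: psi_apply fun_eq_iff)
next
  fix u x
  show "\<exists>F. GL_regular scale F \<and> (\<forall>g\<in>GL scale. psi scale v0 \<xi> g u x = F g)"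
  proof (cases "u \<in> line scale v0")
    case True
    then show ?thesis using GL_regular_alt_form[OF \<xi>, of "case_nat u x"]
      by (intro exI[of _ "\<lambda>g. \<xi> (g \<circ> case_nat u x)"]) (simp add: psi_apply case_nat_comp)
  qed (auto simp: psi_apply intro!: exI[of _ "\<lambda>g. 0"] GL_regular_const)
qed (simp add: psi_apply fun_eq_iff)

lemma line_stabilizer_iff:
  assumes "h \<in> line_stabilizer scale v0"
  shows "h u \<in> line scale v0 \<longleftrightarrow> u \<in> line scale v0"
proof -
  have "inj h" "h ` line scale v0 = line scale v0"
    using assms by (auto simp: line_stabilizer_def GL_def bij_is_inj)
  then show ?thesis by (metis inj_image_mem_iff)
qed

text \<open>Invariance is associativity of composition: both sides evaluate \<open>\<xi>\<close> at
  \<open>g (h u)\<close> and \<open>g \<circ> h \<circ> x\<close>. That \<open>h\<close> preserves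
  the line makes the cut-offs outside it agree.\<close>

lemma psi_in_bal_invariants:
  assumes \<xi>: "\<xi> \<in> alt_forms scale UNIV (Suc p)"
  shows "psi scale v0 \<xi> \<in> bal_invariants scale v0 p"
  unfolding bal_invariants_iff[OF vector_space_axioms]
proof (intro conjI ballI psi_in_bal_tensor \<xi> ext)
  fix g h u x assume g: "g \<in> GL scale" and h: "h \<in> line_stabilizer scale v0"
  then have "h \<in> GL scale" by (simp add: line_stabilizer_def)
  then show "psi scale v0 \<xi> (g \<circ> h) u x = fibre_action (inv_into UNIV h) (psi scale v0 \<xi> g) u x"
    using g by (simp add: fibre_action_def GL_inv_inv psi_apply GL_comp line_stabilizer_iff[OF h] comp_assoc)
qed

section \<open>From equivariant maps back to alternating forms\<close>

lemma bal_invariants_equivariant: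
  assumes "\<phi> \<in> bal_invariants scale v0 p" "g \<in> GL scale" and h: "h \<in> line_stabilizer scale v0"
  shows "\<phi> (g \<circ> h) u x = \<phi> g (h u) (h \<circ> x)"
proof -
  have "h \<in> GL scale" using h by (simp add: line_stabilizer_def)
  then show ?thesis
    using assms by (simp add: bal_invariants_iff[OF vector_space_axioms] fibre_action_def GL_inv_inv)
qed

lemma
  assumes "\<phi> \<in> bal_invariants scale v0 p" "g \<in> GL scale"
  shows bal_invariants_outside: "u \<notin> line scale v0 \<Longrightarrow> \<phi> g u x = 0"
    and bal_invariants_scale: "\<phi> g (c *s v0) x = c * \<phi> g v0 x"
    and bal_invariants_alt: "\<phi> g v0 \<in> alt_forms scale UNIV p"
    and bal_invariants_line: "i < p \<Longrightarrow> x i \<in> line scale v0 \<Longrightarrow> \<phi> g v0 x = 0"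
proof -
  have f: "\<phi> g \<in> fibre scale v0 p"
    using assms by (simp add: bal_invariants_iff[OF vector_space_axioms] bal_tensor_def)
  then show "u \<notin> line scale v0 \<Longrightarrow> \<phi> g u x = 0" by (simp add: fibre_def)
  show "\<phi> g v0 \<in> alt_forms scale UNIV p" "i < p \<Longrightarrow> x i \<in> line scale v0 \<Longrightarrow> \<phi> g v0 x = 0"
    using f scale_self_line unfolding fibre_def by blast+
  have lin: "\<phi> g (a *s u + w) x = a * \<phi> g u x + \<phi> g w x"
    if "u \<in> line scale v0" "w \<in> line scale v0" for a u w
    using f that unfolding fibre_def by blast
  show "\<phi> g (c *s v0) x = c * \<phi> g v0 x"
    using lin[OF scale_self_line zero_line, of c] lin[OF zero_line zero_line, of 1] by simp
qed

text \<open>Since \<open>l w = 0\<close>, inverting the transvection only changes the sign of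
  \<open>t\<close>, so coefficients of the inverse are affine in \<open>t\<close> too.\<close>

lemma GL_regular_transvections:
  assumes "GL_regular scale F" and l: "l \<in> dual_space scale" "l w = 0" and g: "g \<in> GL scale"
  shows "polynomial_map (\<lambda>t. F (transvection l (t *s w) \<circ> g))"
  using assms(1)
proof induction
  case (GL_regular_coeff f v)
  then show ?case
    by (simp add: transvection_def dual_add dual_scale polynomial_map_intros)
next
  case (GL_regular_inv f v)
  have inv: "inv_into UNIV (transvection l (t *s w) \<circ> g) v
      = inv_into UNIV g v + t *s (- l v) *s inv_into UNIV g w" for t
  proof -
    have nz: "1 + l (t *s w) \<noteq> 0" using l by (simp add: dual_scale)
    show ?thesis
      using l GL_inv_comp[OF transvection_GL[OF l(1) nz] g] inv_transvection[OF l(1) nz]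
      by (simp add: transvection_def dual_scale GL_add[OF GL_inv[OF g]] GL_diff[OF GL_inv[OF g]]
          GL_scale[OF GL_inv[OF g]] mult.commute)
  qed
  show ?case
    unfolding inv dual_add[OF GL_regular_inv] dual_scale[OF GL_regular_inv]
    by (intro polynomial_map_intros)
qed (auto intro: polynomial_map_intros)

text \<open>The value of \<open>\<phi>\<close> carried from \<open>v0\<close> to \<open>v\<close>.
  For \<open>\<phi> = psi scale v0 \<xi>\<close> with \<open>\<xi>\<close> alternating it is the
  contraction of \<open>\<xi>\<close> with \<open>v\<close>; this is what makes it the way
  back.\<close>

definition transported :: "'v \<Rightarrow> (('v \<Rightarrow> 'v) \<Rightarrow> 'v \<Rightarrow> (nat \<Rightarrow> 'v) \<Rightarrow> 'k) \<Rightarrow> 'v \<Rightarrow> (nat \<Rightarrow> 'v) \<Rightarrow> 'k" where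
  "transported v0 \<phi> v x = (if v = 0 then 0 else
     let g = (SOME g. g \<in> GL scale \<and> g v0 = v) in \<phi> g v0 (inv_into UNIV g \<circ> x))"

text \<open>Two elements carrying \<open>v0\<close> to the same vector differ by an \<open>h\<close>
  fixing \<open>v0\<close>, hence in the stabilizer; equivariance moves \<open>h\<close> onto the
  arguments, where it cancels.\<close>

lemma transported_eq:
  assumes \<phi>: "\<phi> \<in> bal_invariants scale v0 p" and g: "g \<in> GL scale" and v0: "v0 \<noteq> 0"
  shows "transported v0 \<phi> (g v0) x = \<phi> g v0 (inv_into UNIV g \<circ> x)"
proof -
  define g' where "g' = (SOME g'. g' \<in> GL scale \<and> g' v0 = g v0)"
  have "\<exists>g'. g' \<in> GL scale \<and> g' v0 = g v0" using g by blast
  from someI_ex[OF this] have g': "g' \<in> GL scale" "g' v0 = g v0" by (simp_all add: g'_def)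
  define h where "h = inv_into UNIV g \<circ> g'"
  have h: "h \<in> GL scale" "h v0 = v0"
    using GL_comp[OF GL_inv[OF g] g'(1)] g'(2) GL_inv_left[OF g] by (simp_all add: h_def)
  have "h u = u" if "u \<in> line scale v0" for u using that h by (auto simp: line_iff GL_scale)
  then have "h ` line scale v0 = line scale v0" by (simp cong: image_cong_simp)
  then have stab: "h \<in> line_stabilizer scale v0" using h by (simp add: line_stabilizer_def)
  have "g v0 \<noteq> 0" using v0 GL_inv_left[OF g, of v0] GL_scale[OF GL_inv[OF g], of 0 0] by auto
  then have "transported v0 \<phi> (g v0) x = \<phi> g' v0 (inv_into UNIV g' \<circ> x)"
    by (simp add: transported_def Let_def flip: g'_def)
  also have "g' = g \<circ> h" using GL_inv_right[OF g] by (auto simp: h_def)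
  also have "\<phi> (g \<circ> h) v0 (inv_into UNIV (g \<circ> h) \<circ> x) = \<phi> g v0 (h \<circ> (inv_into UNIV (g \<circ> h) \<circ> x))"
    using bal_invariants_equivariant[OF \<phi> g stab] h by simp
  also have "h \<circ> (inv_into UNIV (g \<circ> h) \<circ> x) = inv_into UNIV g \<circ> x"
    using GL_inv_comp[OF g h(1)] GL_inv_right[OF h(1)] by auto
  finally show ?thesis .
qed

lemma transported_in_kernel:
  assumes \<phi>: "\<phi> \<in> bal_invariants scale v0 p" and v0: "v0 \<noteq> 0"
  shows "transported v0 \<phi> \<in> koszul_kernel scale p"
  unfolding koszul_kernel_iff
proof (intro conjI allI impI)
  note eq = transported_eq[OF \<phi> _ v0]
  show "transported v0 \<phi> v \<in> alt_forms scale UNIV p" for v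
  proof (cases "v = 0")
    case True
    then have "transported v0 \<phi> v = 0" by (simp add: transported_def fun_eq_iff)
    then show ?thesis using zero_in_alt_forms by simp
  next
    case False
    then obtain g where g: "g \<in> GL scale" "g v0 = v" using GL_transitive v0 by blast
    have "(\<lambda>x. \<phi> g v0 (inv_into UNIV g \<circ> x)) \<in> alt_forms scale UNIV p"
      by (rule alt_forms_pullback[OF bal_invariants_alt[OF \<phi> g(1)] GL_linear[OF GL_inv[OF g(1)]]]) simp
    moreover have "transported v0 \<phi> v = (\<lambda>x. \<phi> g v0 (inv_into UNIV g \<circ> x))"
      using eq[OF g(1)] g(2) by (simp add: fun_eq_iff)
    ultimately show ?thesis by simp
  qed
  show "transported v0 \<phi> v x = 0" if k: "k < p \<and> x k = v" for v x k
  proof (cases "v = 0")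
    case False
    then obtain g where g: "g \<in> GL scale" "g v0 = v" using GL_transitive v0 by blast
    have "(inv_into UNIV g \<circ> x) k = v0" using k g GL_inv_left[OF g(1), of v0] by simp
    then have "\<phi> g v0 (inv_into UNIV g \<circ> x) = 0"
      using k scale_self_line by (intro bal_invariants_line[OF \<phi> g(1), of k]) auto
    then show ?thesis using eq[OF g(1)] g(2) by simp
  qed (simp add: transported_def)
  show "(\<lambda>v. transported v0 \<phi> v x) \<in> dual_space scale" for x
  proof (rule homogeneous_polynomial_on_lines_dual)
    show "transported v0 \<phi> (c *s v) x = c * transported v0 \<phi> v x" for c v
    proof (cases "c = 0 \<or> v = 0")
      case False
      then obtain g where g: "g \<in> GL scale" "g v0 = v" using GL_transitive v0 by blast
      \<comment> \<open>Nonzero scalars lie in the stabilizer. Their effect on the arguments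
        \<open>x\<close> cancels against the inverse of \<open>g \<circ> h\<close>, and only the
        factor \<open>c\<close> from \<open>[v0]\<close> survives.\<close>
      define h where "h = scale c"
      have h: "h \<in> GL scale" unfolding h_def
        by (rule GLI(1)[of _ "scale (inverse c)"])
          (use False in \<open>auto simp: scale_right_distrib mult.commute\<close>)
      have "h ` line scale v0 = line scale v0"
      proof (intro equalityI subsetI)
        fix u assume "u \<in> line scale v0"
        then obtain d where "u = d *s v0" by (auto simp: line_iff)
        then have "u = h ((inverse c * d) *s v0)" using False by (simp add: h_def)
        then show "u \<in> h ` line scale v0" by (metis image_eqI line_iff)
      qed (auto simp: h_def line_iff)
      then have stab: "h \<in> line_stabilizer scale v0" using h by (simp add: line_stabilizer_def)
      have "c *s v = (g \<circ> h) v0" using g by (simp add: h_def GL_scale)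
      then have "transported v0 \<phi> (c *s v) x = \<phi> (g \<circ> h) v0 (inv_into UNIV (g \<circ> h) \<circ> x)"
        using eq[OF GL_comp[OF g(1) h]] by simp
      also have "\<dots> = \<phi> g (c *s v0) (h \<circ> (inv_into UNIV (g \<circ> h) \<circ> x))"
        using bal_invariants_equivariant[OF \<phi> g(1) stab] by (simp add: h_def)
      also have "h \<circ> (inv_into UNIV (g \<circ> h) \<circ> x) = inv_into UNIV g \<circ> x"
        using GL_inv_comp[OF g(1) h] GL_inv_right[OF h] by auto
      also have "\<phi> g (c *s v0) \<dots> = c * transported v0 \<phi> v x"
        using eq[OF g(1)] g(2) by (simp add: bal_invariants_scale[OF \<phi> g(1)])
      finally show ?thesis .
    qed (auto simp: transported_def)
    fix u w assume u: "u \<notin> span {w}"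
    then obtain l where l: "l \<in> dual_space scale" "l u = 1" "l w = 0" using dual_separates by blast
    have "u \<noteq> 0" using l dual_zero[OF l(1)] by auto
    then obtain g where g: "g \<in> GL scale" "g v0 = u" using GL_transitive v0 by blast
    \<comment> \<open>\<open>T t\<close> moves \<open>v0\<close> along the line
      \<open>u + t *s w\<close>, is invertible for every \<open>t\<close>, and its inverse acts on
      the arguments affinely in \<open>t\<close>.\<close>
    define T where "T = (\<lambda>t. transvection l (t *s w) \<circ> g)"
    have nz: "1 + l (t *s w) \<noteq> 0" for t using l by (simp add: dual_scale)
    have T: "T t \<in> GL scale" for t
      unfolding T_def by (rule GL_comp[OF transvection_GL[OF l(1) nz] g(1)])
    have Tv0: "T t v0 = u + t *s w" for t using l g by (simp add: T_def transvection_def)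
    have "polynomial_map (\<lambda>t. \<phi> (T t) v0 (\<lambda>i. inv_into UNIV g (x i) + t *s ((- l (x i)) *s inv_into UNIV g w)))"
    proof (rule alt_forms_polynomial[OF subspace_UNIV])
      show "\<phi> (T t) v0 \<in> alt_forms scale UNIV p" for t by (rule bal_invariants_alt[OF \<phi> T])
      show "polynomial_map (\<lambda>t. \<phi> (T t) v0 y)" for y
      proof -
        obtain F where F: "GL_regular scale F" "\<forall>g\<in>GL scale. \<phi> g v0 y = F g"
          using \<phi> unfolding bal_invariants_def bal_tensor_def by blast
        then show ?thesis using GL_regular_transvections[OF F(1) l(1,3) g(1)] T by (simp add: T_def)
      qed
    qed auto
    moreover have "inv_into UNIV (T t) \<circ> x
        = (\<lambda>i. inv_into UNIV g (x i) + t *s ((- l (x i)) *s inv_into UNIV g w))" for t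
      using l GL_inv_comp[OF transvection_GL[OF l(1) nz] g(1), of t] inv_transvection[OF l(1) nz, of t]
      by (simp add: fun_eq_iff T_def transvection_def dual_scale GL_add[OF GL_inv[OF g(1)]]
          GL_diff[OF GL_inv[OF g(1)]] GL_scale[OF GL_inv[OF g(1)]] mult.commute)
    ultimately show "polynomial_map (\<lambda>t. transported v0 \<phi> (u + t *s w) x)"
      using eq[OF T] by (simp add: Tv0)
  qed
qed

lemma psi_bij:
  assumes v0: "v0 \<noteq> 0"
  shows "bij_betw (psi scale v0) (alt_forms scale UNIV (Suc p)) (bal_invariants scale v0 p)"
  unfolding bij_betw_def
proof (intro conjI equalityI subsetI inj_onI)
  fix \<xi> \<zeta> assume \<xi>: "\<xi> \<in> alt_forms scale UNIV (Suc p)" and \<zeta>: "\<zeta> \<in> alt_forms scale UNIV (Suc p)"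
    and eq: "psi scale v0 \<xi> = psi scale v0 \<zeta>"
  have "koszul_first p \<xi> v x = koszul_first p \<zeta> v x" for v x
  proof (cases "v = 0")
    case True
    then show ?thesis using dual_zero[OF alt_forms_head_dual[OF \<xi>]] dual_zero[OF alt_forms_head_dual[OF \<zeta>]]
      by (simp add: koszul_first_apply)
  next
    case False
    then obtain g where g: "g \<in> GL scale" "g v0 = v" using GL_transitive v0 by blast
    \<comment> \<open>Pulling the arguments back by \<open>g\<close> first lets \<open>psi\<close>
      at \<open>g\<close> and \<open>v0\<close> read off \<open>\<xi>\<close> at an arbitrary tuple
      starting with \<open>v\<close>.\<close>
    have "g \<circ> (inv_into UNIV g \<circ> x) = x" using GL_inv_right[OF g(1)] by auto
    then have "psi scale v0 \<xi> g v0 (inv_into UNIV g \<circ> x) = \<xi> (case_nat v x)" for \<xi>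
      using g scale_self_line by (simp add: psi_apply)
    with eq show ?thesis by (metis koszul_first_apply)
  qed
  then have "koszul_first p \<xi> = koszul_first p \<zeta>" by blast
  then show "\<xi> = \<zeta>" using koszul_first_bij[of p] \<xi> \<zeta> by (auto simp: bij_betw_def dest: inj_onD)
next
  fix \<phi> assume \<phi>: "\<phi> \<in> bal_invariants scale v0 p"
  obtain \<xi> where \<xi>: "\<xi> \<in> alt_forms scale UNIV (Suc p)" and eq: "koszul_first p \<xi> = transported v0 \<phi>"
    using koszul_first_bij[of p] transported_in_kernel[OF \<phi> v0] unfolding bij_betw_def by (metis imageE)
  have "psi scale v0 \<xi> g u x = \<phi> g u x" for g u x
  proof (cases "g \<in> GL scale \<and> u \<in> line scale v0")
    case True
    then obtain c where g: "g \<in> GL scale" and u: "u = c *s v0" by (auto simp: line_iff)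
    have "psi scale v0 \<xi> g u x = \<xi> (case_nat (c *s g v0) (g \<circ> x))"
      using True by (simp add: psi_apply u GL_scale)
    also have "\<dots> = c * \<xi> (case_nat (g v0) (g \<circ> x))" by (rule dual_scale[OF alt_forms_head_dual[OF \<xi>]])
    also have "\<xi> (case_nat (g v0) (g \<circ> x)) = transported v0 \<phi> (g v0) (g \<circ> x)"
      by (simp flip: eq add: koszul_first_apply)
    also have "\<dots> = \<phi> g v0 (inv_into UNIV g \<circ> (g \<circ> x))" by (rule transported_eq[OF \<phi> g v0])
    also have "inv_into UNIV g \<circ> (g \<circ> x) = x" using GL_inv_left[OF g] by auto
    finally show ?thesis by (simp add: u bal_invariants_scale[OF \<phi> g])
  next
    case False
    have "\<phi> g = 0" if "g \<notin> GL scale"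
      using \<phi> that by (simp add: bal_invariants_def bal_tensor_def)
    then show ?thesis using False bal_invariants_outside[OF \<phi>, of g u x]
      by (cases "g \<in> GL scale") (auto simp: psi_apply)
  qed
  then have "psi scale v0 \<xi> = \<phi>" by (simp add: fun_eq_iff)
  with \<xi> show "\<phi> \<in> psi scale v0 ` alt_forms scale UNIV (Suc p)" by blast
qed (use psi_in_bal_invariants in auto)

section \<open>The two descriptions as isomorphisms of modules\<close>

lemma form_action_alt:
  assumes "\<xi> \<in> alt_forms scale UNIV q" "g \<in> GL scale"
  shows "form_action g \<xi> \<in> alt_forms scale UNIV q"
  unfolding form_action_def
  by (rule alt_forms_pullback[OF assms(1) GL_linear[OF GL_inv[OF assms(2)]]]) simp

text \<open>Translating the section by the inverse of \<open>g\<close> translates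
  \<open>\<xi>\<close> into its coaction at \<open>g\<close>, and evaluation at \<open>[v0]\<close>
  is then the dual of the exterior product. No scalar arises.\<close>

lemma bundle_description_form_section:
  assumes \<xi>: "\<xi> \<in> alt_forms scale UNIV (Suc p)"
  shows "bundle_description scale v0 (form_section p \<xi>) = psi scale v0 \<xi>"
proof (intro ext)
  fix g u x
  show "bundle_description scale v0 (form_section p \<xi>) g u x = psi scale v0 \<xi> g u x"
  proof (cases "g \<in> GL scale \<and> u \<in> line scale v0 \<and> u \<noteq> 0")
    case True
    then have g: "g \<in> GL scale" and u: "u \<in> line scale v0" "u \<noteq> 0" by auto
    have "bundle_description scale v0 (form_section p \<xi>) g u x
        = cone_value scale (form_section p (form_action (inv_into UNIV g) \<xi>)) u x"
      using g u by (simp add: bundle_description_def fibre_value_def section_action_form_section GL_inv)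
    also have "\<dots> = form_action (inv_into UNIV g) \<xi> (case_nat u x)"
      by (rule cone_value_form_section[OF form_action_alt[OF \<xi> GL_inv[OF g]] u(2)])
    finally show ?thesis using g u by (simp add: form_action_def GL_inv_inv psi_apply case_nat_comp)
  next
    case False
    \<comment> \<open>\<open>fibre_value\<close> is cut off at \<open>u = 0\<close> whereas
      \<open>psi\<close> is not; they agree because \<open>\<xi>\<close> is linear in its first
      argument.\<close>
    have "\<xi> (case_nat (g 0) (g \<circ> x)) = 0" if "g \<in> GL scale"
      using GL_scale[OF that, of 0 0] dual_zero[OF alt_forms_head_dual[OF \<xi>]] by simp
    then show ?thesis using False by (auto simp: bundle_description_def fibre_value_def psi_apply)
  qed
qed

text \<open>Two out of three: the composite with \<open>koszul_description\<close> is
  \<open>psi\<close>, and both of these are bijective. Regularity of the map attached to a section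
  is thereby inherited from \<open>psi\<close>.\<close>

lemma bundle_description_bij:
  assumes "v0 \<noteq> 0"
  shows "bij_betw (bundle_description scale v0) (proj_forms scale p (p + 1)) (bal_invariants scale v0 p)"
proof -
  have "bij_betw (bundle_description scale v0 \<circ> koszul_description scale p)
      (alt_forms scale UNIV (Suc p)) (bal_invariants scale v0 p)"
    using psi_bij[OF assms, of p]
    by (rule bij_betw_cong[THEN iffD1, rotated]) (simp add: koszul_description_eq bundle_description_form_section)
  then show ?thesis using bij_betw_comp_iff[OF koszul_description_bij] by blast
qed

lemma koszul_description_iso:
  "GL_module_iso scale (alt_forms scale UNIV (p + 1)) scale_form form_action
     (proj_forms scale p (p + 1)) scale_map section_action (koszul_description scale p)"
  unfolding GL_module_iso_def
proof (intro conjI ballI allI)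
  show "bij_betw (koszul_description scale p) (alt_forms scale UNIV (p + 1)) (proj_forms scale p (p + 1))"
    using koszul_description_bij[of p] by simp
  fix \<xi> assume "\<xi> \<in> alt_forms scale UNIV (p + 1)"
  then have \<xi>: "\<xi> \<in> alt_forms scale UNIV (Suc p)" by simp
  show "koszul_description scale p (\<xi> + \<zeta>) = koszul_description scale p \<xi> + koszul_description scale p \<zeta>"
    if "\<zeta> \<in> alt_forms scale UNIV (p + 1)" for \<zeta>
    using \<xi> that alt_forms_plus[OF \<xi>, of \<zeta>]
    by (auto simp: koszul_description_eq fun_eq_iff form_section_def)
  show "koszul_description scale p (scale_form c \<xi>) = scale_map c (koszul_description scale p \<xi>)" for c
    using \<xi> alt_forms_scale_form[OF \<xi>, of c]
    by (auto simp: koszul_description_eq fun_eq_iff form_section_def scale_form_def scale_map_def)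
  show "koszul_description scale p (form_action g \<xi>) = section_action g (koszul_description scale p \<xi>)"
    if "g \<in> GL scale" for g
    using \<xi> form_action_alt[OF \<xi> that] that
    by (simp add: koszul_description_eq section_action_form_section)
qed

lemma bundle_description_iso:
  assumes "v0 \<noteq> 0"
  shows "GL_module_iso scale (proj_forms scale p (p + 1)) scale_map section_action
     (bal_invariants scale v0 p) scale_map left_translation (bundle_description scale v0)"
  unfolding GL_module_iso_def
proof (intro conjI ballI allI bundle_description_bij assms)
  fix s
  \<comment> \<open>The chart chosen in \<open>cone_value\<close> depends on the point alone, so
    everything is pointwise linear in the section.\<close>
  show "bundle_description scale v0 (s + t) = bundle_description scale v0 s + bundle_description scale v0 t" for t
    by (auto simp: fun_eq_iff bundle_description_def fibre_value_def cone_value_def section_action_def Let_def)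
  show "bundle_description scale v0 (scale_map c s) = scale_map c (bundle_description scale v0 s)" for c
    by (auto simp: fun_eq_iff bundle_description_def fibre_value_def cone_value_def section_action_def
        scale_map_def Let_def)
  show "bundle_description scale v0 (section_action g s) = left_translation g (bundle_description scale v0 s)"
    if g: "g \<in> GL scale" for g
  proof
    fix g'
    have GL: "inv_into UNIV g \<circ> g' \<in> GL scale \<longleftrightarrow> g' \<in> GL scale"
    proof
      assume "inv_into UNIV g \<circ> g' \<in> GL scale"
      from GL_comp[OF g this] show "g' \<in> GL scale" by (simp add: comp_def GL_inv_right[OF g])
    qed (rule GL_comp[OF GL_inv[OF g]])
    show "bundle_description scale v0 (section_action g s) g' = left_translation g (bundle_description scale v0 s) g'"
    proof (cases "g' \<in> GL scale")
      case True
      have "inv_into UNIV (inv_into UNIV g \<circ> g') = inv_into UNIV g' \<circ> g"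
        using GL_inv_comp[OF GL_inv[OF g] True] by (simp add: GL_inv_inv[OF g])
      then show ?thesis using True GL
        by (simp add: bundle_description_def left_translation_def section_action_comp[OF GL_inv[OF True] g])
    qed (simp add: bundle_description_def left_translation_def GL)
  qed
qed

end

text \<open>The bijectivity of \<open>euler_map\<close> and \<open>koszul_first\<close> belongs to
  the conclusion because it makes \<open>inv_into\<close> in \<open>koszul_description\<close> a
  genuine inverse.\<close>

theorem proposition13:
  fixes scale :: "'k::field_char_0 \<Rightarrow> 'v::ab_group_add \<Rightarrow> 'v"
    and Basis :: "'v set" and v0 :: 'v and p :: nat
  assumes "finite_dimensional_vector_space scale Basis"
    and "v0 \<noteq> 0"
  shows "(\<forall>\<xi>\<in>alt_forms scale UNIV (p + 1). psi scale v0 \<xi> \<in> bal_invariants scale v0 p) \<and>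
    bij_betw (koszul_first p) (alt_forms scale UNIV (p + 1)) (koszul_kernel scale p) \<and>
    bij_betw (euler_map scale) (proj_forms scale p (p + 1)) (koszul_kernel scale p) \<and>
    GL_module_iso scale
      (alt_forms scale UNIV (p + 1)) scale_form form_action
      (proj_forms scale p (p + 1)) scale_map section_action
      (koszul_description scale p) \<and>
    GL_module_iso scale
      (proj_forms scale p (p + 1)) scale_map section_action
      (bal_invariants scale v0 p) scale_map left_translation
      (bundle_description scale v0) \<and>
    (\<exists>c. c \<noteq> 0 \<and> (\<forall>\<xi>\<in>alt_forms scale UNIV (p + 1).
      psi scale v0 \<xi> = scale_map c ((bundle_description scale v0 \<circ> koszul_description scale p) \<xi>)))"
proof -
  interpret fin_dim_char_0_space scale Basis using assms(1) by (simp add: fin_dim_char_0_space_def)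
  have "psi scale v0 \<xi> = scale_map 1 ((bundle_description scale v0 \<circ> koszul_description scale p) \<xi>)"
    if "\<xi> \<in> alt_forms scale UNIV (Suc p)" for \<xi>
    using that by (simp add: scale_map_def koszul_description_eq bundle_description_form_section)
  then have "\<exists>c. c \<noteq> 0 \<and> (\<forall>\<xi>\<in>alt_forms scale UNIV (p + 1).
      psi scale v0 \<xi> = scale_map c ((bundle_description scale v0 \<circ> koszul_description scale p) \<xi>))"
    by (intro exI[of _ 1]) simp
  moreover have "bij_betw (koszul_first p) (alt_forms scale UNIV (p + 1)) (koszul_kernel scale p)"
    using koszul_first_bij[of p] by simp
  ultimately show ?thesis
    using psi_in_bal_invariants euler_map_bij koszul_description_iso bundle_description_iso[OF assms(2)]
    by simp
qed

end
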